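(* Let $K$ be a field of characteristic zero, let $d$ be a positive integer, and let $P_1(z),\ldots,P_d(z)\in K[z]$ be polynomials with $P_d(z)$ a nonzero constant polynomial. Suppose that $f:\mathbb{N}\to K$ is a sequence satisfying $$f(n)=\sum_{i=1}^d P_i(n)\,f(n-i)$$ for all sufficiently large $n$. Then the set $\{n\in\mathbb{N} : f(n)=0\}$ is a union of finitely many arithmetic progressions and a finite set.
   Context: $\mathbb{N}=\{0,1,2,\ldots\}$. *)

theory Defs
  imports "HOL-Computational_Algebra.Polynomial"
begin

(* Infinite progressions only: a zero common difference (a singleton) is excluded. *)
definition arithmetic_progression :: "nat set \<Rightarrow> bool" where
  "arithmetic_progression A \<longleftrightarrow> (\<exists>a b. a > 0 \<and> A = {a * k + b | k. True})"

end

theory Submission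
  imports Defs "HOL-Computational_Algebra.Primes" "HOL-Library.FuncSet"
begin

text \<open>
  The argument is a form of the Skolem--Mahler--Lech method without \<open>p\<close>-adic numbers. Every finite subset
  of \<open>K\<close> lies in a subring \<open>R = I 0\<close> with a multiplicative filtration \<open>I 0 \<supseteq> I 1 \<supseteq> \<dots>\<close> such that
  \<open>\<Inter>k. I k\<close> is trivial, \<open>R / I 1\<close> is finite, and dividing by an odd prime \<open>p \<in> I 1\<close> lowers the filtration
  by exactly one. Over the rationals this is the \<open>p\<close>-adic filtration; it extends to a simple algebraic
  extension coefficientwise with respect to a power basis, and to a simple transcendental extension
  by giving a local parameter weight one.

  Since \<open>P\<^sub>d\<close> is a unit of \<open>R\<close>, the recurrence can be run backwards modulo \<open>I 1\<close>, so it is periodic in the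
  finite ring \<open>R / I 1\<close>, with a period \<open>a\<close> that may be taken divisible by \<open>p\<^sup>2\<close>. Hence the \<open>k\<close>-th differences
  of \<open>f\<close> with step \<open>a\<close> lie in \<open>I k\<close>. As in Strassmann's theorem, if \<open>m \<mapsto> f (b + a m)\<close> has infinitely many
  zeros, then dividing its Newton interpolation polynomials by many of the factors \<open>X - m\<close> shows that all
  its values lie in every \<open>I k\<close>, so they vanish.
\<close>

section \<open>Filtrations\<close>

text \<open>
  \<open>I 0\<close> is a subring, \<open>I k\<close> plays the role of the elements of valuation at least \<open>k\<close>.
\<close>

locale padic_filtration =
  fixes p :: nat and I :: "nat \<Rightarrow> 'a::field_char_0 set"
  assumes prime_p: "prime p" and p_gt_2: "2 < p"
    and one_mem: "1 \<in> I 0"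
    and diff_mem: "x \<in> I k \<Longrightarrow> y \<in> I k \<Longrightarrow> x - y \<in> I k"
    and mult_mem: "x \<in> I j \<Longrightarrow> y \<in> I k \<Longrightarrow> x * y \<in> I (j + k)"
    and Suc_subset: "I (Suc k) \<subseteq> I k"
    and p_mem: "of_nat p \<in> I 1"
    and separated: "(\<And>k. x \<in> I k) \<Longrightarrow> x = 0"
    and p_cancel: "x \<in> I 0 \<Longrightarrow> of_nat p * x \<in> I (Suc k) \<Longrightarrow> x \<in> I k"
    and finite_residues: "\<exists>T. finite T \<and> (\<forall>x\<in>I 0. \<exists>t\<in>T. x - t \<in> I 1)"
begin

lemma antimono_mem: "x \<in> I l \<Longrightarrow> k \<le> l \<Longrightarrow> x \<in> I k"
  using lift_Suc_antimono_le[of I k l] Suc_subset by blast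

lemma p_power_mem: "of_nat p ^ k \<in> I k"
proof (induction k)
  case (Suc k)
  from mult_mem[OF p_mem Suc] show ?case by simp
qed (simp add: one_mem)

lemma zero_mem: "0 \<in> I k"
  using diff_mem[OF p_power_mem p_power_mem] by simp

lemma uminus_mem: "x \<in> I k \<Longrightarrow> - x \<in> I k"
  using diff_mem[OF zero_mem] by simp

lemma add_mem: "x \<in> I k \<Longrightarrow> y \<in> I k \<Longrightarrow> x + y \<in> I k"
  using diff_mem[of x k "- y"] uminus_mem by simp

lemma sum_mem: "(\<And>i. i \<in> A \<Longrightarrow> f i \<in> I k) \<Longrightarrow> sum f A \<in> I k"
  by (induction A rule: infinite_finite_induct) (auto simp: zero_mem add_mem)

lemma mult_mem_left: "x \<in> I 0 \<Longrightarrow> y \<in> I k \<Longrightarrow> x * y \<in> I k"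
  using mult_mem[of x 0 y k] by simp

lemma mult_mem_right: "x \<in> I k \<Longrightarrow> y \<in> I 0 \<Longrightarrow> x * y \<in> I k"
  using mult_mem[of x k y 0] by simp

lemma of_nat_mem: "of_nat n \<in> I 0"
  by (induction n) (auto simp: zero_mem add_mem one_mem)

lemma of_int_mem: "of_int n \<in> I 0"
  by (cases n) (auto simp: of_nat_mem intro!: uminus_mem diff_mem one_mem simp del: of_nat_Suc)

lemma of_nat_dvd_mem: "p ^ k dvd n \<Longrightarrow> of_nat n \<in> I k"
  by (auto elim!: dvdE intro!: mult_mem_right p_power_mem of_nat_mem)

lemma of_nat_multiplicity_mem: "of_nat n \<in> I (multiplicity p n)"
  by (rule of_nat_dvd_mem) (rule multiplicity_dvd)

lemma p_power_cancel: "x \<in> I 0 \<Longrightarrow> of_nat p ^ j * x \<in> I (j + k) \<Longrightarrow> x \<in> I k"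
proof (induction j)
  case (Suc j)
  have "of_nat p ^ j * x \<in> I 0"
    using Suc.prems(1) antimono_mem[OF p_power_mem] by (intro mult_mem_left) auto
  moreover have "of_nat p * (of_nat p ^ j * x) \<in> I (Suc (j + k))"
    using Suc.prems(2) by (simp add: mult.assoc)
  ultimately have "of_nat p ^ j * x \<in> I (j + k)" by (rule p_cancel)
  then show ?case using Suc by blast
qed simp

text \<open>Bezout for \<open>n\<close> and \<open>p ^ k\<close> writes \<open>x\<close> as a
  combination of \<open>n x\<close> and \<open>p ^ k x\<close>, both of which lie in
  \<open>I k\<close>.\<close>

lemma coprime_cancel:
  assumes "coprime n p" "x \<in> I 0" "of_nat n * x \<in> I k"
  shows "x \<in> I k"
proof -
  have "coprime (int n) (int p ^ k)" using assms(1) by simp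
  then obtain u v where uv: "u * int n + v * int p ^ k = 1"
    by (metis bezout_int coprime_imp_gcd_eq_1)
  have "x = of_int (u * int n + v * int p ^ k) * x" using uv by simp
  also have "\<dots> = of_int u * (of_nat n * x) + of_int v * (of_nat p ^ k * x)"
    by (simp add: algebra_simps)
  also have "\<dots> \<in> I k"
    using assms by (intro add_mem mult_mem_left[OF of_int_mem] mult_mem_right[OF p_power_mem])
  finally show ?thesis .
qed

lemma of_nat_cancel:
  assumes "n > 0" "x \<in> I 0" "of_nat n * x \<in> I (multiplicity p n + k)"
  shows "x \<in> I k"
proof -
  obtain m where m: "n = p ^ multiplicity p n * m" "\<not> p dvd m"
    using multiplicity_decompose'[of n p] assms(1) prime_p
    by (metis not_prime_unit gr_implies_not0)
  define v where "v = multiplicity p n"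
  have "coprime m p" using prime_imp_coprime[OF prime_p m(2)] by (simp add: coprime_commute)
  moreover have "of_nat m * (of_nat p ^ v * x) \<in> I (v + k)"
  proof -
    have "of_nat n = (of_nat p ^ v * of_nat m :: 'a)"
      using arg_cong[OF m(1), of "of_nat :: nat \<Rightarrow> 'a"] by (simp only: of_nat_mult of_nat_power v_def)
    then show ?thesis using assms(3) by (simp add: v_def ac_simps)
  qed
  moreover have "of_nat p ^ v * x \<in> I 0"
    using assms(2) antimono_mem[OF p_power_mem] by (intro mult_mem_left) auto
  ultimately have "of_nat p ^ v * x \<in> I (v + k)"
    using coprime_cancel[of m "of_nat p ^ v * x"] by simp
  then show ?thesis using p_power_cancel assms(2) by blast
qed

end

section \<open>Newton differences and the size of factorials\<close>

definition step_diff :: "nat \<Rightarrow> (nat \<Rightarrow> 'a::ab_group_add) \<Rightarrow> nat \<Rightarrow> 'a" where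
  "step_diff a g n = g (n + a) - g n"

text \<open>Newton's forward difference formula. The induction hypothesis is applied to both
  \<open>g\<close> and \<open>step_diff a g\<close>; Pascal's rule merges the two sums.\<close>

lemma step_diff_newton:
  fixes g :: "nat \<Rightarrow> 'a::comm_ring_1"
  shows "g (n + a * x) = (\<Sum>k\<le>x. of_nat (x choose k) * (step_diff a ^^ k) g n)"
proof (induction x arbitrary: g)
  case (Suc x)
  let ?D = "\<lambda>k. (step_diff a ^^ k) g n"
  have "g (n + a * Suc x) = g (n + a * x) + step_diff a g (n + a * x)"
    by (simp add: step_diff_def algebra_simps)
  also have "\<dots> = (\<Sum>k\<le>x. of_nat (x choose k) * ?D k) + (\<Sum>k\<le>x. of_nat (x choose k) * ?D (Suc k))"
    by (simp add: Suc[of g] Suc[of "step_diff a g"] funpow_Suc_right del: funpow.simps)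
  also have "(\<Sum>k\<le>x. of_nat (x choose k) * ?D k) = (\<Sum>k\<le>Suc x. of_nat (x choose k) * ?D k)"
    by (simp add: binomial_eq_0)
  also have "\<dots> = ?D 0 + (\<Sum>k\<le>x. of_nat (x choose Suc k) * ?D (Suc k))"
    by (simp only: sum.atMost_Suc_shift) simp
  also have "\<dots> + (\<Sum>k\<le>x. of_nat (x choose k) * ?D (Suc k)) =
      ?D 0 + (\<Sum>k\<le>x. of_nat (Suc x choose Suc k) * ?D (Suc k))"
    by (simp add: sum.distrib algebra_simps del: funpow.simps)
  also have "\<dots> = (\<Sum>k\<le>Suc x. of_nat (Suc x choose k) * ?D k)"
    by (simp only: sum.atMost_Suc_shift) simp
  finally show ?case .
qed simp

text \<open>Legendre's bound \<open>n / (p - 1)\<close>, weakened to \<open>n / 2\<close> for odd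
  \<open>p\<close>. The half of \<open>k\<close> that remains in \<open>k - v(k!)\<close> drives the
  root count in \<open>infinite_zeros_imp_zero\<close>.\<close>

lemma multiplicity_fact_le:
  assumes "prime p" "2 < (p::nat)"
  shows "2 * multiplicity p (fact n :: nat) \<le> n"
proof -
  \<comment> \<open>Legendre's recursion: among the factors of \<open>(p m + r)!\<close> only the
    \<open>m\<close> multiples of \<open>p\<close> count, and removing one \<open>p\<close> from
    each leaves \<open>m!\<close>. The induction adds one factor at a time.\<close>
  have step: "multiplicity p (fact (p * m + r) :: nat) = m + multiplicity p (fact m :: nat)"
    if "r < p" for m r
    using that
  proof (induction "p * m + r" arbitrary: m r)
    case 0
    then show ?case using assms by auto
  next
    case (Suc n)
    show ?case
    proof (cases r)
      case 0
      then obtain m' where m: "m = Suc m'" using Suc(2) by (cases m) auto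
      have n: "n = p * m' + (p - 1)" using Suc(2) 0 m assms by simp
      have "multiplicity p (fact n :: nat) = m' + multiplicity p (fact m' :: nat)"
        using Suc(1)[OF n] assms n by simp
      moreover have "fact (p * m + r) = p * m * (fact n :: nat)"
        using fact_Suc[of n, where 'a = nat] unfolding Suc(2) 0 by simp
      moreover have "multiplicity p (p * m * (fact n :: nat)) = 1 + multiplicity p m + multiplicity p (fact n :: nat)"
        using assms m prime_gt_1_nat[OF assms(1)]
        by (subst prime_elem_multiplicity_mult_distrib)
          (auto simp: multiplicity_times_same simp del: mult_Suc_right)
      moreover have "multiplicity p (fact m :: nat) = multiplicity p m + multiplicity p (fact m' :: nat)"
        using assms m by (simp add: prime_elem_multiplicity_mult_distrib del: mult_Suc)
      ultimately show ?thesis using m by simp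
    next
      case (Suc r')
      have n: "n = p * m + r'" using Suc.hyps(2) Suc by simp
      have "\<not> p dvd p * m + r" using Suc.prems Suc nat_dvd_not_less[of r p] by (simp add: dvd_add_right_iff del: add_Suc_right)
      then have "multiplicity p (p * m + r) = 0" by (rule not_dvd_imp_multiplicity_0)
      moreover have "multiplicity p ((p * m + r) * fact n) = multiplicity p (p * m + r) + multiplicity p (fact n :: nat)"
        using assms Suc by (intro prime_elem_multiplicity_mult_distrib) auto
      moreover have "fact (p * m + r) = (p * m + r) * (fact n :: nat)"
        using fact_Suc[of n, where 'a = nat] unfolding Suc.hyps(2) by simp
      ultimately have "multiplicity p (fact (p * m + r) :: nat) = multiplicity p (fact n :: nat)"
        by (metis add_0)
      also have "\<dots> = m + multiplicity p (fact m :: nat)"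
        using Suc.hyps(1)[OF n] Suc.prems Suc unfolding n by linarith
      finally show ?thesis .
    qed
  qed
  show ?thesis
  proof (induction n rule: less_induct)
    case (less n)
    show ?case
    proof (cases "n = 0")
      case False
      define m where "m = n div p"
      have "p * m \<le> n" by (simp add: m_def)
      have "m < n" using False assms by (simp add: m_def)
      then have "2 * multiplicity p (fact m :: nat) \<le> m" by (rule less)
      moreover have "multiplicity p (fact n :: nat) = m + multiplicity p (fact m :: nat)"
        using step[of "n mod p" m] assms by (simp add: m_def)
      \<comment> \<open>Altogether
        \<open>2 v(n!) = 2 m + 2 v(m!) \<le> 3 m \<le> p m \<le> n\<close>.\<close>
      moreover have "3 * m \<le> p * m" using assms by (intro mult_right_mono) auto
      ultimately show ?thesis using \<open>p * m \<le> n\<close> by linarith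
    qed simp
  qed
qed

section \<open>Differences of solutions of linear recurrences\<close>

context padic_filtration
begin

text \<open>
  The bound \<open>K\<close> on the order of the differences is there for the induction in
  \<open>recurrence_diff_small\<close>, where smallness of differences up to order \<open>K\<close> yields order \<open>K + 1\<close>.
\<close>

primrec diff_small :: "nat \<Rightarrow> nat \<Rightarrow> nat \<Rightarrow> (nat \<Rightarrow> 'a) \<Rightarrow> bool" where
  "diff_small a 0 l g \<longleftrightarrow> (\<forall>n. g n \<in> I l)"
| "diff_small a (Suc K) l g \<longleftrightarrow> (\<forall>n. g n \<in> I l) \<and> diff_small a K (Suc l) (step_diff a g)"

lemma diff_small_iterate: "diff_small a K l g \<Longrightarrow> (step_diff a ^^ K) g n \<in> I (K + l)"
  by (induction K arbitrary: l g) (auto simp: funpow_Suc_right simp del: funpow.simps(2), fastforce)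

lemma diff_small_decr: "diff_small a K (Suc l) g \<Longrightarrow> diff_small a K l g"
  by (induction K arbitrary: l g) (auto intro: antimono_mem)

lemma diff_small_Suc: "diff_small a (Suc K) l g \<Longrightarrow> diff_small a K l g"
  by (induction K arbitrary: l g) auto

lemma step_diff_add: "step_diff a (\<lambda>n. g n + h n) = (\<lambda>n. step_diff a g n + step_diff a h n)"
  by (auto simp: step_diff_def)

lemma diff_small_add: "diff_small a K l g \<Longrightarrow> diff_small a K l h \<Longrightarrow> diff_small a K l (\<lambda>n. g n + h n)"
  by (induction K arbitrary: l g h) (auto simp: step_diff_add intro: add_mem)

lemma diff_small_shift: "diff_small a K l g \<Longrightarrow> diff_small a K l (\<lambda>n. g (n + s))"
proof (induction K arbitrary: l g)
  case (Suc K)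
  have "step_diff a (\<lambda>n. g (n + s)) = (\<lambda>n. step_diff a g (n + s))"
    by (auto simp: step_diff_def add_ac)
  with Suc show ?case by auto
qed auto

text \<open>Discrete Leibniz rule: in each of the two products the differenced factor moves up a
  level, while the other, known to order \<open>Suc K\<close>, is used only to order
  \<open>K\<close>.\<close>

lemma diff_small_mult:
  "diff_small a K l g \<Longrightarrow> diff_small a K l' h \<Longrightarrow> diff_small a K (l + l') (\<lambda>n. g n * h n)"
proof (induction K arbitrary: l l' g h)
  case (Suc K)
  have "step_diff a (\<lambda>n. g n * h n) = (\<lambda>n. step_diff a g n * h (n + a) + g n * step_diff a h n)"
    by (auto simp: step_diff_def algebra_simps)
  moreover have "diff_small a K (Suc l + l') (\<lambda>n. step_diff a g n * h (n + a))"
    using Suc.prems(1) by (intro Suc.IH diff_small_shift diff_small_Suc[OF Suc.prems(2)]) simp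
  moreover have "diff_small a K (l + Suc l') (\<lambda>n. g n * step_diff a h n)"
    using Suc.prems(2) by (intro Suc.IH diff_small_Suc[OF Suc.prems(1)]) simp
  moreover have "g n * h n \<in> I (l + l')" for n
    using Suc.prems by (intro mult_mem) auto
  ultimately show ?case by (auto intro!: diff_small_add)
qed (auto intro: mult_mem)

lemma diff_small_const: "x \<in> I l \<Longrightarrow> diff_small a K l (\<lambda>_. x)"
proof (induction K arbitrary: l x)
  case (Suc K)
  have "step_diff a (\<lambda>_. x) = (\<lambda>_. 0)" by (auto simp: step_diff_def)
  with Suc show ?case by (auto intro: zero_mem)
qed auto

lemma diff_small_sum:
  "(\<And>i. i \<in> A \<Longrightarrow> diff_small a K l (g i)) \<Longrightarrow> diff_small a K l (\<lambda>n. \<Sum>i\<in>A. g i n)"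
proof (induction A rule: infinite_finite_induct)
  case (insert x F)
  then show ?case by (auto intro!: diff_small_add)
qed (auto intro!: diff_small_const zero_mem)

text \<open>
  Polynomial sequences are flat once \<open>p\<^sup>2\<close> divides the step. If all values of a flat \<open>g\<close> lie in \<open>I 1\<close>,
  then already \<open>\<Delta>\<^sup>k g \<in> I (k + 1)\<close> for every \<open>k\<close>.
\<close>

definition flat :: "nat \<Rightarrow> (nat \<Rightarrow> 'a) \<Rightarrow> bool" where
  "flat a g \<longleftrightarrow> (\<forall>n. g n \<in> I 0) \<and> (\<forall>K. diff_small a K 2 (step_diff a g))"

lemma flat_diff_small_0: "flat a g \<Longrightarrow> diff_small a K 0 g"
  unfolding flat_def by (cases K) (auto simp: numeral_2_eq_2 intro: diff_small_decr)

lemma flat_diff_small_1: "flat a g \<Longrightarrow> (\<And>n. g n \<in> I 1) \<Longrightarrow> diff_small a K 1 g"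
  unfolding flat_def by (cases K) (auto simp: numeral_2_eq_2)

lemma flat_const: "x \<in> I 0 \<Longrightarrow> flat a (\<lambda>_. x)"
  unfolding flat_def using diff_small_const[OF zero_mem] by (simp add: step_diff_def[abs_def])

lemma flat_add: "flat a g \<Longrightarrow> flat a h \<Longrightarrow> flat a (\<lambda>n. g n + h n)"
  unfolding flat_def by (auto simp: step_diff_add intro: diff_small_add add_mem)

lemma flat_mult:
  assumes "flat a g" "flat a h"
  shows "flat a (\<lambda>n. g n * h n)"
proof -
  have "step_diff a (\<lambda>n. g n * h n) = (\<lambda>n. step_diff a g n * h (n + a) + g n * step_diff a h n)"
    by (auto simp: step_diff_def algebra_simps)
  moreover have "diff_small a K (2 + 0) (\<lambda>n. step_diff a g n * h (n + a))" for K
    using assms by (intro diff_small_mult diff_small_shift flat_diff_small_0) (auto simp: flat_def)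
  moreover have "diff_small a K (0 + 2) (\<lambda>n. g n * step_diff a h n)" for K
    using assms by (intro diff_small_mult flat_diff_small_0) (auto simp: flat_def)
  ultimately show ?thesis using assms unfolding flat_def
    by (simp add: diff_small_add mult_mem_left del: One_nat_def add_2_eq_Suc')
qed

lemma flat_sum: "(\<And>i. i \<in> A \<Longrightarrow> flat a (g i)) \<Longrightarrow> flat a (\<lambda>n. \<Sum>i\<in>A. g i n)"
proof (induction A rule: infinite_finite_induct)
  case (insert x F)
  then show ?case by (auto intro!: flat_add)
qed (auto intro!: flat_const zero_mem)

text \<open>The difference of the identity is the constant \<open>a\<close>, which
  \<open>p\<^sup>2 dvd a\<close> puts into \<open>I 2\<close>; all further differences
  vanish.\<close>

lemma flat_of_nat: "p\<^sup>2 dvd a \<Longrightarrow> flat a of_nat"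
  unfolding flat_def step_diff_def
  using diff_small_const[OF of_nat_dvd_mem, of 2 a] by (auto simp: of_nat_mem)

lemma flat_shift: "flat a g \<Longrightarrow> flat a (\<lambda>n. g (n + s))"
proof -
  assume "flat a g"
  moreover have "step_diff a (\<lambda>n. g (n + s)) = (\<lambda>n. step_diff a g (n + s))"
    by (auto simp: step_diff_def add_ac)
  ultimately show ?thesis by (auto simp: flat_def intro: diff_small_shift)
qed

lemma flat_poly:
  assumes "p\<^sup>2 dvd a" "\<And>i. coeff q i \<in> I 0"
  shows "flat a (\<lambda>n. poly q (of_nat n))"
  using assms(2)
proof (induction q)
  case 0
  show ?case by (simp add: flat_const zero_mem)
next
  case (pCons c q)
  have "c \<in> I 0" using pCons.prems[of 0] by simp
  moreover have "coeff q i \<in> I 0" for i using pCons.prems[of "Suc i"] by simp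
  ultimately show ?case using pCons.IH
    by (auto intro!: flat_add flat_const flat_mult flat_of_nat assms(1))
qed

lemma poly_mem: "(\<And>i. coeff q i \<in> I k) \<Longrightarrow> x \<in> I 0 \<Longrightarrow> poly q x \<in> I k"
proof (induction q)
  case (pCons c q)
  have "c \<in> I k" using pCons.prems(1)[of 0] by simp
  moreover have "coeff q i \<in> I k" for i using pCons.prems(1)[of "Suc i"] by simp
  ultimately show ?case using pCons by (auto intro!: add_mem mult_mem_left)
qed (simp add: zero_mem)

lemma poly_cong_mem:
  assumes "\<And>i. coeff q i \<in> I 0" "x \<in> I 0" "y \<in> I 0" "x - y \<in> I k"
  shows "poly q x - poly q y \<in> I k"
  using assms(1)
proof (induction q)
  case (pCons c q)
  have *: "coeff q i \<in> I 0" for i using pCons.prems(1)[of "Suc i"] by simp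
  have "poly (pCons c q) x - poly (pCons c q) y = (x - y) * poly q x + y * (poly q x - poly q y)"
    by (simp add: algebra_simps)
  also have "\<dots> \<in> I k" using pCons.IH[OF *] * assms
    by (intro add_mem mult_mem_left[of y] mult_mem_right[of "x - y"] poly_mem) auto
  finally show ?case .
qed (simp add: zero_mem)

text \<open>One fixed finite set of representatives serves all \<open>x\<close>, and the condition
  on \<open>t\<close> depends only on the class of \<open>x\<close> modulo \<open>I 1\<close>, so
  congruent elements receive the same choice. On \<open>I 0\<close> this turns congruence into
  equality in a finite set.\<close>

definition residue :: "'a \<Rightarrow> 'a" where
  "residue x = (SOME t. t \<in> (SOME T. finite T \<and> (\<forall>x\<in>I 0. \<exists>t\<in>T. x - t \<in> I 1)) \<and> x - t \<in> I 1)"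

lemma finite_residue_range: "finite (residue ` I 0)"
  and residue_eq_iff: "x \<in> I 0 \<Longrightarrow> y \<in> I 0 \<Longrightarrow> residue x = residue y \<longleftrightarrow> x - y \<in> I 1"
proof -
  define T where "T = (SOME T. finite T \<and> (\<forall>x\<in>I 0. \<exists>t\<in>T. x - t \<in> I 1))"
  have T: "finite T \<and> (\<forall>x\<in>I 0. \<exists>t\<in>T. x - t \<in> I 1)"
    unfolding T_def by (rule someI_ex) (rule finite_residues)
  have eq: "residue x = (SOME t. t \<in> T \<and> x - t \<in> I 1)" for x
    unfolding residue_def T_def ..
  have res: "residue x \<in> T \<and> x - residue x \<in> I 1" if "x \<in> I 0" for x
    using someI_ex[of "\<lambda>t. t \<in> T \<and> x - t \<in> I 1"] T that unfolding eq by blast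
  show "finite (residue ` I 0)"
    using T res by (meson finite_subset image_subsetI)
  show "residue x = residue y \<longleftrightarrow> x - y \<in> I 1" if "x \<in> I 0" "y \<in> I 0"
  proof
    assume "residue x = residue y"
    then show "x - y \<in> I 1"
      using diff_mem[OF conjunct2[OF res[OF that(1)]] conjunct2[OF res[OF that(2)]]] by simp
  next
    assume xy: "x - y \<in> I 1"
    have "x - t \<in> I 1 \<longleftrightarrow> y - t \<in> I 1" for t
      using diff_mem[OF _ xy, of "x - t"] add_mem[OF _ xy, of "y - t"] by auto
    then show "residue x = residue y" unfolding eq by simp
  qed
qed

end

section \<open>A uniform period modulo \<open>I 1\<close>\<close>

text \<open>Pigeonhole gives a repetition among the first \<open>card X + 1\<close> terms, and
  reversibility carries it back to index 0. The factorial is a multiple of the resulting period and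
  depends only on \<open>card X\<close>, so it serves all such sequences at once.\<close>

lemma reversible_periodic:
  assumes "finite X" "\<And>s. y s \<in> X" "\<And>s t. y (Suc s) = y (Suc t) \<longleftrightarrow> y s = y t"
  shows "y (fact (card X) * m) = y (0::nat)"
proof -
  have "\<not> inj_on y {..card X}"
    using card_inj_on_le[of y "{..card X}" X] assms(1,2) by auto
  then obtain s t where st: "s < t" "t \<le> card X" "y s = y t"
    unfolding inj_on_def by (metis atMost_iff linorder_neqE_nat)
  define e where "e = t - s"
  have shift: "y (s + k) = y (t + k) \<longleftrightarrow> y s = y t" for s t k
    by (induction k) (auto simp: assms(3))
  have "y (0 + s) = y (e + s) \<longleftrightarrow> y 0 = y e" by (rule shift)
  then have e: "y e = y 0" using st by (simp add: e_def)
  have "y (e * k) = y 0" for k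
  proof (induction k)
    case (Suc k)
    have "y (e * k + e) = y (0 + e)" using shift[of "e * k" e 0] Suc by simp
    then show ?case using e by (simp add: add.commute)
  qed simp
  moreover have "e dvd fact (card X)" using st by (intro dvd_fact) (auto simp: e_def)
  ultimately show ?thesis by (metis dvdE mult.assoc)
qed

text \<open>As a function of \<open>s\<close>, this is the solution of the recurrence started at
  \<open>n\<close> whose initial values form the \<open>j\<close>-th unit vector. Its windows of
  length \<open>d\<close>, taken over all \<open>j\<close>, are products of companion
  matrices.\<close>

function transition :: "nat \<Rightarrow> (nat \<Rightarrow> nat \<Rightarrow> 'a::comm_ring_1) \<Rightarrow> nat \<Rightarrow> nat \<Rightarrow> nat \<Rightarrow> 'a" where
  "transition d q j n s = (if s < d then if s = j then 1 else 0
     else \<Sum>i<d. q i (n + (s - d)) * transition d q j n (s - d + i))"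
  by pat_completeness auto
termination by (relation "measure (\<lambda>(d, q, j, n, s). s)") auto

declare transition.simps [simp del]

lemma transition_init: "s < d \<Longrightarrow> transition d q j n s = (if s = j then 1 else 0)"
  by (simp add: transition.simps)

lemma transition_rec: "transition d q j n (s + d) = (\<Sum>i<d. q i (n + s) * transition d q j n (s + i))"
  by (subst transition.simps) simp

lemma recurrence_transition:
  fixes g :: "nat \<Rightarrow> 'a::comm_ring_1"
  assumes "\<And>n. g (n + d) = (\<Sum>i<d. q i n * g (n + i))"
  shows "g (n + s) = (\<Sum>j<d. transition d q j n s * g (n + j))"
proof (induction s rule: less_induct)
  case (less s)
  show ?case
  proof (cases "s < d")
    case True
    then have "(\<Sum>j<d. transition d q j n s * g (n + j)) = (\<Sum>j<d. if s = j then g (n + j) else 0)"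
      by (intro sum.cong) (auto simp: transition_init)
    then show ?thesis using True by simp
  next
    case False
    define r where "r = s - d"
    have s: "s = r + d" using False by (simp add: r_def)
    have "g (n + s) = (\<Sum>i<d. q i (n + r) * g (n + (r + i)))"
      using assms[of "n + r"] by (simp add: s add_ac)
    also have "\<dots> = (\<Sum>i<d. q i (n + r) * (\<Sum>j<d. transition d q j n (r + i) * g (n + j)))"
      using less s by (intro sum.cong arg_cong2[of _ _ _ _ "(*)"]) auto
    also have "\<dots> = (\<Sum>j<d. transition d q j n s * g (n + j))"
      unfolding s transition_rec sum_distrib_left sum_distrib_right
      by (subst sum.swap) (simp add: mult.assoc)
    finally show ?thesis .
  qed
qed

context padic_filtration
begin

lemma mult_cong_mem:
  assumes "x \<in> I 0" "y' \<in> I 0" "x - x' \<in> I k" "y - y' \<in> I k"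
  shows "x * y - x' * y' \<in> I k"
proof -
  have "x * y - x' * y' = x * (y - y') + (x - x') * y'" by (simp add: algebra_simps)
  then show ?thesis using assms by (simp add: add_mem mult_mem_left mult_mem_right)
qed

lemma of_nat_cong_mem:
  assumes "s mod p = t mod p"
  shows "of_nat s - of_nat t \<in> I 1"
proof -
  have decomp: "of_nat m = of_nat p * of_nat (m div p) + (of_nat (m mod p) :: 'a)" for m
    by (simp flip: of_nat_mult of_nat_add)
  have "of_nat s - of_nat t = of_nat p * (of_nat (s div p) - of_nat (t div p) :: 'a)"
    unfolding decomp[of s] decomp[of t] assms by (simp add: algebra_simps)
  also have "\<dots> \<in> I 1"
    by (intro mult_mem_right[OF p_mem] diff_mem of_nat_mem)
  finally show ?thesis .
qed

context
  fixes d :: nat and Q :: "nat \<Rightarrow> 'a poly" and c :: 'a and q :: "nat \<Rightarrow> nat \<Rightarrow> 'a"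
  assumes d_pos: "d > 0" and coeff_Q: "\<And>j i. coeff (Q j) i \<in> I 0"
    and Q_0: "Q 0 = [:c:]" and c_nonzero: "c \<noteq> 0" and inverse_c: "inverse c \<in> I 0"
  defines "q \<equiv> \<lambda>j n. poly (Q j) (of_nat n)"
begin

lemma q_mem: "q j n \<in> I 0"
  unfolding q_def by (intro poly_mem coeff_Q of_nat_mem)

lemma flat_q: "p\<^sup>2 dvd a \<Longrightarrow> flat a (q j)"
  unfolding q_def by (intro flat_poly coeff_Q)

lemma q_cong:
  assumes "s mod p = t mod p"
  shows "q j (n + s) - q j (n + t) \<in> I 1"
proof -
  have "(n + s) mod p = (n + t) mod p" using assms by (metis mod_add_right_eq)
  then show ?thesis
    unfolding q_def by (intro poly_cong_mem coeff_Q of_nat_mem of_nat_cong_mem)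
qed

lemma transition_mem: "transition d q j n s \<in> I 0"
proof (induction s rule: less_induct)
  case (less s)
  then show ?case
    by (subst transition.simps) (auto intro!: sum_mem mult_mem_left q_mem one_mem zero_mem)
qed

lemma flat_transition:
  assumes "p\<^sup>2 dvd a"
  shows "flat a (\<lambda>n. transition d q j n s)"
proof (induction s rule: less_induct)
  case (less s)
  show ?case
  proof (cases "s < d")
    case True
    then show ?thesis by (simp add: transition_init flat_const one_mem zero_mem)
  next
    case False
    have "flat a (\<lambda>n. \<Sum>i<d. q i (n + (s - d)) * transition d q j n (s - d + i))"
      using False less by (intro flat_sum flat_mult flat_shift flat_q assms) auto
    then show ?thesis using False by (subst transition.simps) simp
  qed
qed

text \<open>The windows at \<open>s\<close> and \<open>Suc s\<close> share \<open>d - 1\<close>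
  entries. If these agree modulo \<open>I 1\<close>, the difference of the new entries is
  \<open>c\<close> times that of the dropped ones modulo \<open>I 1\<close>, and \<open>c\<close> is
  a unit of \<open>I 0\<close>. The assumption on \<open>s mod p\<close> makes the coefficients at
  \<open>n + s\<close> and \<open>n + t\<close> congruent.\<close>

lemma transition_cong_Suc_iff:
  assumes "s mod p = t mod p"
  shows "(\<forall>i<d. transition d q j n (Suc s + i) - transition d q j n (Suc t + i) \<in> I 1) \<longleftrightarrow>
         (\<forall>i<d. transition d q j n (s + i) - transition d q j n (t + i) \<in> I 1)"
    (is "?L \<longleftrightarrow> ?R")
proof -
  let ?U = "transition d q j n"
  obtain e where d: "d = Suc e" using d_pos by (cases d) auto
  define m where "m = (\<forall>i<e. ?U (Suc s + i) - ?U (Suc t + i) \<in> I 1)"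
  define \<Delta> where "\<Delta> = (\<Sum>i<e. q (Suc i) (n + s) * ?U (s + Suc i) - q (Suc i) (n + t) * ?U (t + Suc i))"
  have q_0: "q 0 k = c" for k by (simp add: q_def Q_0)
  have c_mem: "c \<in> I 0" using coeff_Q[of 0 0] by (simp add: Q_0)
  have eq: "?U (s + d) - ?U (t + d) = c * (?U s - ?U t) + \<Delta>"
    unfolding transition_rec \<Delta>_def
    by (simp add: d sum.lessThan_Suc_shift q_0 sum_subtractf algebra_simps del: sum.lessThan_Suc)
  have \<Delta>: "\<Delta> \<in> I 1" if m
    unfolding \<Delta>_def using that assms
    by (intro sum_mem mult_cong_mem q_mem transition_mem q_cong) (auto simp: m_def)
  have "?L \<longleftrightarrow> m \<and> ?U (s + d) - ?U (t + d) \<in> I 1"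
    by (auto simp: m_def d less_Suc_eq)
  also have "\<dots> \<longleftrightarrow> m \<and> ?U s - ?U t \<in> I 1"
  proof (intro conj_cong refl iffI)
    assume m and *: "?U (s + d) - ?U (t + d) \<in> I 1"
    have "?U s - ?U t = inverse c * (?U (s + d) - ?U (t + d) - \<Delta>)"
      unfolding eq using c_nonzero by simp
    then show "?U s - ?U t \<in> I 1"
      using mult_mem_left[OF inverse_c diff_mem[OF * \<Delta>[OF \<open>m\<close>]]] by simp
  next
    assume m "?U s - ?U t \<in> I 1"
    then show "?U (s + d) - ?U (t + d) \<in> I 1"
      unfolding eq by (intro add_mem mult_mem_left c_mem \<Delta>)
  qed
  also have "\<dots> \<longleftrightarrow> ?R"
    by (auto simp: m_def d All_less_Suc2)
  finally show ?thesis .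
qed

text \<open>Modulo \<open>I 1\<close> the polynomial coefficients depend on \<open>s\<close> only
  through \<open>s mod p\<close>, so this is recorded along with the residues of the window. The
  states form a reversible sequence in a finite set \<open>X\<close> independent of
  \<open>n\<close>, whence one \<open>a\<close> serves all \<open>n\<close>.\<close>

lemma transition_periodic:
  obtains a where "a > 0" "p\<^sup>2 dvd a"
    "\<And>i j n. i < d \<Longrightarrow> j < d \<Longrightarrow> transition d q j n (a + i) - (if i = j then 1 else 0) \<in> I 1"
proof -
  define X where "X = {..<p} \<times> (({..<d} \<times> {..<d}) \<rightarrow>\<^sub>E residue ` I 0)"
  \<comment> \<open>The factor \<open>p\<^sup>2\<close> keeps \<open>a\<close> a period and makes
    polynomial sequences flat for the step \<open>a\<close>.\<close>
  define a where "a = fact (card X) * p\<^sup>2"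
  have p_pos: "p > 0" using p_gt_2 by simp
  have "transition d q j n (a + i) - (if i = j then 1 else 0) \<in> I 1" if ij: "i < d" "j < d" for i j n
  proof -
    define y where "y = (\<lambda>s. (s mod p,
      restrict (\<lambda>(i, j). residue (transition d q j n (s + i))) ({..<d} \<times> {..<d})))"
    have y_eq: "y s = y t \<longleftrightarrow> s mod p = t mod p \<and>
        (\<forall>j<d. \<forall>i<d. transition d q j n (s + i) - transition d q j n (t + i) \<in> I 1)" for s t
      by (auto simp: y_def fun_eq_iff restrict_def residue_eq_iff[OF transition_mem transition_mem])
    have Suc_mod: "Suc s mod p = Suc t mod p \<longleftrightarrow> s mod p = t mod p" for s t
      by (auto simp: mod_Suc)
    have "finite X" unfolding X_def by (intro finite_cartesian_product finite_PiE finite_residue_range) auto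
    moreover have "y s \<in> X" for s
      unfolding X_def y_def using p_pos by (auto intro!: imageI transition_mem)
    moreover have "y (Suc s) = y (Suc t) \<longleftrightarrow> y s = y t" for s t
      unfolding y_eq Suc_mod using transition_cong_Suc_iff[of s t] by (intro conj_cong) auto
    ultimately have "y a = y 0"
      unfolding a_def by (rule reversible_periodic)
    then have "transition d q j n (a + i) - transition d q j n (0 + i) \<in> I 1"
      using ij unfolding y_eq by blast
    then show ?thesis using ij by (simp add: transition_init)
  qed
  moreover have "a > 0" "p\<^sup>2 dvd a" using p_pos by (auto simp: a_def)
  ultimately show thesis using that by blast
qed

text \<open>The difference of the window of \<open>g\<close> at \<open>n\<close> is the transition
  matrix over \<open>a\<close> steps minus the identity, applied to that window. The entries of this
  matrix are flat and lie in \<open>I 1\<close>, so each differencing gains a level.\<close>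

lemma recurrence_diff_small:
  obtains a where "a > 0"
    "\<And>g K n. (\<And>n. g (n + d) = (\<Sum>i<d. q i n * g (n + i))) \<Longrightarrow> (\<And>n. n < d \<Longrightarrow> g n \<in> I 0)
      \<Longrightarrow> (step_diff a ^^ K) g n \<in> I K"
proof -
  obtain a where a: "a > 0" "p\<^sup>2 dvd a"
    and per: "\<And>i j n. i < d \<Longrightarrow> j < d \<Longrightarrow> transition d q j n (a + i) - (if i = j then 1 else 0) \<in> I 1"
    using transition_periodic by blast
  have "(step_diff a ^^ K) g n \<in> I K"
    if rec: "\<And>n. g (n + d) = (\<Sum>i<d. q i n * g (n + i))" and init: "\<And>n. n < d \<Longrightarrow> g n \<in> I 0" for g K n
  proof -
    define E where "E = (\<lambda>i j n. transition d q j n (a + i) + (if i = j then - 1 else 0))"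
    have E_small: "diff_small a K 1 (E i j)" if "i < d" "j < d" for i j K
    proof (rule flat_diff_small_1)
      show "flat a (E i j)" unfolding E_def
        by (intro flat_add flat_transition a flat_const) (auto intro: zero_mem uminus_mem one_mem)
      show "E i j n \<in> I 1" for n using per[OF that, of n] by (auto simp: E_def split: if_splits)
    qed
    have g_mem: "g n \<in> I 0" for n
      using recurrence_transition[OF rec, of 0 n]
      by (auto intro!: sum_mem mult_mem_left transition_mem init)
    have diff: "step_diff a (\<lambda>n. g (n + i)) = (\<lambda>n. \<Sum>j<d. E i j n * g (n + j))" if "i < d" for i
    proof
      fix n
      have "(\<Sum>j<d. E i j n * g (n + j)) =
          (\<Sum>j<d. transition d q j n (a + i) * g (n + j)) + (\<Sum>j<d. if i = j then - g (n + j) else 0)"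
        unfolding sum.distrib[symmetric] E_def by (intro sum.cong) (auto simp: algebra_simps)
      then show "step_diff a (\<lambda>n. g (n + i)) n = (\<Sum>j<d. E i j n * g (n + j))"
        using recurrence_transition[OF rec, of n "a + i"] that by (simp add: step_diff_def add_ac)
    qed
    \<comment> \<open>All \<open>d\<close> shifts are treated together because the difference of one
      involves all of them.\<close>
    have "\<forall>i<d. diff_small a K 0 (\<lambda>n. g (n + i))"
    proof (induction K)
      case (Suc K)
      have "diff_small a K (1 + 0) (\<lambda>n. \<Sum>j<d. E i j n * g (n + j))" if "i < d" for i
        using Suc that by (intro diff_small_sum diff_small_mult E_small) auto
      then show ?case by (auto simp: diff g_mem)
    qed (simp add: g_mem)
    from diff_small_iterate[OF this[rule_format, OF d_pos]] show ?thesis by simp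
  qed
  with a show thesis using that by blast
qed

end

section \<open>Strassmann's root count for interpolation polynomials\<close>

text \<open>
  Each division by a linear factor shifts the coefficients down by one, hence improves the bound.
\<close>

lemma root_quotient_coeff_mem:
  assumes "\<And>i. coeff ([:- of_nat y, 1:] * r) i \<in> I (k + (i + l) div 2)"
  shows "coeff r i \<in> I (k + (i + Suc l) div 2)"
proof -
  \<comment> \<open>Descent from the degree: beyond it the coefficients vanish, and
    \<open>coeff r i\<close> is obtained from \<open>coeff r (Suc i)\<close>. Here \<open>m\<close>
    bounds how far \<open>i\<close> lies below the degree.\<close>
  have "coeff r i \<in> I (k + (i + Suc l) div 2)" if "degree r < i + m" for i m
    using that
  proof (induction m arbitrary: i)
    case 0
    then show ?case by (simp add: coeff_eq_0 zero_mem)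
  next
    case (Suc m)
    have eq: "coeff r i = coeff ([:- of_nat y, 1:] * r) (Suc i) + of_nat y * coeff r (Suc i)"
      by simp
    have "coeff r (Suc i) \<in> I (k + (i + Suc l) div 2)"
      using Suc by (intro antimono_mem[OF Suc.IH]) auto
    then show ?case unfolding eq
      using assms[of "Suc i"] by (intro add_mem mult_mem_left of_nat_mem) (auto simp del: mult_pCons_left)
  qed
  from this[of i "Suc (degree r)"] show ?thesis by simp
qed

text \<open>\<open>l\<close> counts the roots already divided out. When none are left, evaluation
  retains the bound of the constant coefficient; multiplying back by the factors
  \<open>x - y\<close> in \<open>I 0\<close> loses nothing.\<close>

lemma poly_mem_of_roots:
  assumes "finite A" "\<And>y. y \<in> A \<Longrightarrow> poly h (of_nat y) = 0"
    and "\<And>i. coeff h i \<in> I (k + (i + l) div 2)"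
  shows "poly h (of_nat x) \<in> I (k + (l + card A) div 2)"
  using assms
proof (induction A arbitrary: h l rule: finite_induct)
  case empty
  then have "coeff h i \<in> I (k + l div 2)" for i
    using antimono_mem[OF empty(2)[of i]] by (simp add: div_le_mono)
  then show ?case by (simp add: poly_mem of_nat_mem)
next
  case (insert y A)
  obtain r where r: "h = [:- of_nat y, 1:] * r"
    using insert.prems(1)[of y] by (auto simp: poly_eq_0_iff_dvd)
  have "poly r (of_nat z) = 0" if "z \<in> A" for z
    using insert.prems(1)[of z] insert.hyps that by (auto simp: r)
  moreover have "coeff r i \<in> I (k + (i + Suc l) div 2)" for i
    using insert.prems(2) unfolding r by (rule root_quotient_coeff_mem)
  ultimately have "poly r (of_nat x) \<in> I (k + (Suc l + card A) div 2)"
    by (rule insert.IH)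
  then have "(of_nat x - of_nat y) * poly r (of_nat x) \<in> I (k + (Suc l + card A) div 2)"
    by (intro mult_mem_left diff_mem of_nat_mem)
  then show ?case using insert.hyps by (simp add: r left_diff_distrib)
qed

lemma falling_poly_coeff_mem: "coeff (\<Prod>i<k. [:- of_nat i, 1:]) j \<in> I 0"
proof (induction k arbitrary: j)
  case (Suc k)
  have "coeff (\<Prod>i<Suc k. [:- of_nat i, 1:]) j =
      (case j of 0 \<Rightarrow> 0 | Suc j' \<Rightarrow> coeff (\<Prod>i<k. [:- of_nat i, 1:]) j')
      - of_nat k * coeff (\<Prod>i<k. [:- of_nat i, 1 :: 'a:]) j"
    by (simp add: mult.commute[of _ "[:_, 1:]"] coeff_pCons split: nat.split)
  then show ?case using Suc
    by (auto intro!: diff_mem mult_mem_left uminus_mem of_nat_mem zero_mem split: nat.split)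
qed (auto simp: one_mem zero_mem)

end

lemma degree_falling_poly: "degree (\<Prod>i<k. [:- of_nat i, 1 :: 'a::field_char_0:]) = k"
  by (subst degree_prod_eq_sum_degree) auto

lemma poly_falling_poly:
  "poly (\<Prod>i<k. [:- of_nat i, 1:]) (of_nat x) = (fact k * of_nat (x choose k) :: 'a::field_char_0)"
  by (simp add: poly_prod binomial_gbinomial gbinomial_prod_rev lessThan_atLeast0)

context padic_filtration
begin

text \<open>For each level \<open>v\<close> finitely many zeros suffice: the scaled interpolation
  polynomial takes values \<open>v\<close> levels deeper than the scaling factor \<open>K!\<close>,
  which is then cancelled.\<close>

lemma infinite_zeros_imp_zero:
  assumes small: "\<And>k n. (step_diff a ^^ k) g n \<in> I k"
    and inf: "infinite {m. g (n + a * m) = 0}"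
  shows "g (n + a * x) = 0"
proof (rule separated)
  fix v
  \<comment> \<open>Each root gains half a level, so \<open>2 * v\<close> of them are taken.\<close>
  obtain A where A: "finite A" "card A = 2 * v" "A \<subseteq> {m. g (n + a * m) = 0}"
    using infinite_arbitrarily_large[OF inf] by blast
  \<comment> \<open>Newton's polynomial truncated at \<open>K\<close> interpolates at
    \<open>0, ..., K\<close>; this range has to contain \<open>x\<close> and the chosen
    zeros.\<close>
  define K where "K = Max (insert x A)"
  have K: "m \<le> K" if "m \<in> insert x A" for m
    unfolding K_def using A that by (intro Max_ge) auto
  define D where "D = (\<lambda>k. (step_diff a ^^ k) g n)"
  \<comment> \<open>Newton's interpolation polynomial of \<open>m \<mapsto> g (n + a * m)\<close>, scaled by \<open>K!\<close> because \<open>I 0\<close> need not be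
    closed under division by \<open>k!\<close>.\<close>
  define h where "h = (\<Sum>k\<le>K. smult (of_nat (fact K div fact k) * D k) (\<Prod>i<k. [:- of_nat i, 1:]))"
  have h: "poly h (of_nat m) = of_nat (fact K) * g (n + a * m)" if "m \<le> K" for m
  proof -
    have fact_div: "of_nat (fact K div fact k) * fact k = (fact K :: 'a)" if "k \<le> K" for k
    proof -
      have "fact K div fact k * fact k = (fact K :: nat)" using that by (intro dvd_div_mult_self fact_dvd)
      then show ?thesis by (metis of_nat_fact of_nat_mult)
    qed
    have "poly h (of_nat m) =
        (\<Sum>k\<le>K. of_nat (fact K div fact k) * D k * (fact k * of_nat (m choose k)))"
      unfolding h_def by (simp only: poly_sum poly_smult poly_falling_poly)
    also have "\<dots> = (\<Sum>k\<le>K. fact K * (of_nat (m choose k) * D k))"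
      by (intro sum.cong refl) (simp add: fact_div[symmetric])
    also have "\<dots> = fact K * (\<Sum>k\<le>K. of_nat (m choose k) * D k)"
      by (simp add: sum_distrib_left)
    also have "(\<Sum>k\<le>K. of_nat (m choose k) * D k) = (\<Sum>k\<le>m. of_nat (m choose k) * D k)"
      using that by (intro sum.mono_neutral_right) (auto simp: binomial_eq_0)
    also have "\<dots> = g (n + a * m)" by (simp add: step_diff_newton D_def)
    finally show ?thesis by simp
  qed
  let ?v = "\<lambda>k. multiplicity p (fact k :: nat)"
  \<comment> \<open>Only terms with \<open>i \<le> k\<close> contribute to the coefficient at
    \<open>i\<close>. They lie at level \<open>v(K!) - v(k!) + k\<close>, which is at least
    \<open>v(K!) + i div 2\<close> because \<open>2 v(k!) \<le> k\<close>.\<close>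
  have "coeff h i \<in> I (?v K + (i + 0) div 2)" for i
  proof -
    have "of_nat (fact K div fact k) * D k * coeff (\<Prod>i<k. [:- of_nat i, 1:]) i \<in> I (?v K + i div 2)"
      if "k \<le> K" for k
    proof (cases "i \<le> k")
      case True
      have "fact k * (fact K div fact k) = (fact K :: nat)"
        using that by (intro dvd_mult_div_cancel fact_dvd)
      moreover from this have "fact K div fact k \<noteq> (0 :: nat)" by (metis fact_nonzero mult_0_right)
      ultimately have "?v K = ?v k + multiplicity p (fact K div fact k)"
        using prime_elem_multiplicity_mult_distrib[of p "fact k" "fact K div fact k"] prime_p by simp
      moreover have "2 * ?v k \<le> k" using multiplicity_fact_le[OF prime_p p_gt_2] .
      ultimately have "?v K + i div 2 \<le> multiplicity p (fact K div fact k) + k"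
        using True by linarith
      moreover have "of_nat (fact K div fact k) * D k \<in> I (multiplicity p (fact K div fact k) + k)"
        unfolding D_def by (intro mult_mem of_nat_multiplicity_mem small)
      ultimately have "of_nat (fact K div fact k) * D k \<in> I (?v K + i div 2)"
        by (rule antimono_mem[rotated])
      then show ?thesis by (rule mult_mem_right) (rule falling_poly_coeff_mem)
    next
      case False
      then show ?thesis by (simp add: coeff_eq_0 degree_falling_poly zero_mem)
    qed
    then show ?thesis unfolding h_def coeff_sum by (intro sum_mem) simp
  qed
  then have "poly h (of_nat x) \<in> I (?v K + (0 + card A) div 2)"
    using A K h by (intro poly_mem_of_roots) auto
  then have "of_nat (fact K) * g (n + a * x) \<in> I (?v K + v)"
    using h[of x] K A by simp
  moreover have "g (n + a * x) \<in> I 0" using small[of 0] by simp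
  ultimately show "g (n + a * x) \<in> I v"
    using of_nat_cancel[of "fact K" "g (n + a * x)" v] by simp
qed

end

section \<open>Existence of filtrations\<close>

context padic_filtration
begin

text \<open>The variable gets weight one.\<close>

definition graded :: "nat \<Rightarrow> 'a poly \<Rightarrow> bool" where
  "graded k a \<longleftrightarrow> (\<forall>i. coeff a i \<in> I (k - i))"

lemma graded_mem_0: "graded k a \<Longrightarrow> coeff a i \<in> I 0"
  unfolding graded_def using antimono_mem by blast

lemma graded_antimono: "graded l a \<Longrightarrow> k \<le> l \<Longrightarrow> graded k a"
  unfolding graded_def by (meson antimono_mem diff_le_mono)

lemma graded_diff: "graded k a \<Longrightarrow> graded k b \<Longrightarrow> graded k (a - b)"
  unfolding graded_def by (auto intro: diff_mem)

lemma graded_mult: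
  assumes "graded k a" "graded l b"
  shows "graded (k + l) (a * b)"
  unfolding graded_def coeff_mult
proof (intro allI sum_mem)
  fix i j :: nat
  assume "j \<in> {..i}"
  have "coeff a j * coeff b (i - j) \<in> I ((k - j) + (l - (i - j)))"
    using assms by (intro mult_mem) (auto simp: graded_def)
  then show "coeff a j * coeff b (i - j) \<in> I (k + l - i)"
    by (rule antimono_mem) (use \<open>j \<in> {..i}\<close> in auto)
qed

lemma graded_mult_0: "graded k a \<Longrightarrow> graded 0 b \<Longrightarrow> graded k (a * b)"
  using graded_mult[of k a 0 b] by simp

lemma graded_const: "c \<in> I k \<Longrightarrow> graded k [:c:]"
  unfolding graded_def by (auto simp: coeff_pCons zero_mem split: nat.split)

text \<open>As in inverting a power series with constant term 1, the coefficients of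
  \<open>a\<close> are recovered one by one from those of \<open>a * b\<close>. For
  \<open>j < i\<close> the earlier ones lie in \<open>I (k - j)\<close>, hence in
  \<open>I (k - i)\<close>.\<close>

lemma graded_mult_cancel:
  assumes "graded k (a * b)" "graded 0 b" "coeff b 0 = 1"
  shows "graded k a"
  unfolding graded_def
proof
  fix i
  show "coeff a i \<in> I (k - i)"
  proof (induction i rule: less_induct)
    case (less i)
    have "coeff (a * b) i = (\<Sum>j<i. coeff a j * coeff b (i - j)) + coeff a i"
      unfolding coeff_mult lessThan_Suc_atMost[symmetric] by (simp add: assms(3))
    then have "coeff a i = coeff (a * b) i - (\<Sum>j<i. coeff a j * coeff b (i - j))"
      by simp
    also have "\<dots> \<in> I (k - i)"
    proof (intro diff_mem sum_mem mult_mem_right)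
      fix j assume "j \<in> {..<i}"
      then show "coeff a j \<in> I (k - i)" using antimono_mem[OF less[of j], of "k - i"] by simp
    qed (use assms in \<open>auto simp: graded_def\<close>)
    finally show ?case .
  qed
qed

text \<open>Denominators with constant term 1 can be cancelled from graded products, and
  transcendence turns equal values into equal polynomials. Separatedness and cancellation of
  \<open>p\<close> thus reduce to the coefficients of one fixed numerator.\<close>

lemma transcendental_extension:
  assumes transcendental: "\<And>q. (\<And>i. coeff q i \<in> I 0) \<Longrightarrow> poly q t = 0 \<Longrightarrow> q = 0"
  shows "padic_filtration p
    (\<lambda>k. {poly a t / poly b t | a b. graded k a \<and> graded 0 b \<and> coeff b 0 = 1})"
    (is "padic_filtration p ?J")
proof -
  have nz: "poly b t \<noteq> 0" if "graded 0 b" "coeff b 0 = 1" for b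
    using transcendental[of b] graded_mem_0[OF that(1)] that(2) by auto
  have inj: "a = b" if "poly a t = poly b t" "graded k a" "graded l b" for a b k l
    using transcendental[of "a - b"] that by (auto intro: diff_mem graded_mem_0)
  have J: "poly a t / poly b t \<in> ?J k" if "graded k a" "graded 0 b" "coeff b 0 = 1" for a b k
    using that by blast
  have graded_1: "graded 0 1" using graded_const[OF one_mem] by (simp add: one_pCons)
  show ?thesis
  proof
    show "1 \<in> ?J 0" using J[OF graded_1 graded_1] by simp
  next
    fix x y k
    assume "x \<in> ?J k" "y \<in> ?J k"
    then obtain a b a' b' where x: "x = poly a t / poly b t" and y: "y = poly a' t / poly b' t"
      and g: "graded k a" "graded 0 b" "coeff b 0 = 1" "graded k a'" "graded 0 b'" "coeff b' 0 = 1"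
      by auto
    have "x - y = poly (a * b' - a' * b) t / poly (b * b') t"
      using nz[of b] nz[of b'] g by (simp add: x y field_simps)
    also have "\<dots> \<in> ?J k"
      using g by (intro J graded_diff graded_mult_0) (auto simp: coeff_mult)
    finally show "x - y \<in> ?J k" .
  next
    fix x y j k
    assume "x \<in> ?J j" "y \<in> ?J k"
    then obtain a b a' b' where x: "x = poly a t / poly b t" and y: "y = poly a' t / poly b' t"
      and g: "graded j a" "graded 0 b" "coeff b 0 = 1" "graded k a'" "graded 0 b'" "coeff b' 0 = 1"
      by auto
    have "x * y = poly (a * a') t / poly (b * b') t" by (simp add: x y)
    also have "\<dots> \<in> ?J (j + k)"
      using g by (intro J graded_mult graded_mult_0) (auto simp: coeff_mult)
    finally show "x * y \<in> ?J (j + k)" .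
  next
    fix k
    show "?J (Suc k) \<subseteq> ?J k" using graded_antimono[of "Suc k" _ k] by auto
  next
    show "of_nat p \<in> ?J 1" using J[OF graded_const[OF p_mem] graded_1] by simp
  next
    fix x
    assume x: "\<And>k. x \<in> ?J k"
    obtain a b where ab: "x = poly a t / poly b t" "graded 0 a" "graded 0 b" "coeff b 0 = 1"
      using x[of 0] by auto
    have "graded k a" for k
    proof -
      obtain a' b' where ab': "x = poly a' t / poly b' t" "graded k a'" "graded 0 b'" "coeff b' 0 = 1"
        using x[of k] by auto
      have "poly (a * b') t = poly (a' * b) t"
        using ab ab' nz[of b] nz[of b'] by (simp add: field_simps)
      then have "a * b' = a' * b"
        using ab ab' by (intro inj[of _ _ 0 k] graded_mult_0)
      then have "graded k (a * b')" using graded_mult_0[of k a' b] ab ab' by simp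
      then show ?thesis using graded_mult_cancel ab' by blast
    qed
    then have "coeff a i \<in> I k" for i k
      using graded_def[of "k + i" a] by (metis add_diff_cancel_right')
    then have "a = 0" using separated by (intro poly_eqI) simp
    then show "x = 0" using ab by simp
  next
    fix x k
    assume x: "x \<in> ?J 0" and px: "of_nat p * x \<in> ?J (Suc k)"
    obtain a b where ab: "x = poly a t / poly b t" "graded 0 a" "graded 0 b" "coeff b 0 = 1"
      using x by auto
    obtain a' b' where ab': "of_nat p * x = poly a' t / poly b' t"
      "graded (Suc k) a'" "graded 0 b'" "coeff b' 0 = 1"
      using px by auto
    have g: "graded 0 [:of_nat p:]" by (intro graded_const of_nat_mem)
    have "poly a t = x * poly b t" "poly a' t = of_nat p * x * poly b' t"
      using ab ab' nz[of b] nz[of b'] by simp_all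
    then have "poly ([:of_nat p:] * a * b') t = poly (a' * b) t"
      by (simp add: mult_ac)
    then have "[:of_nat p:] * a * b' = a' * b"
      using ab ab' g by (intro inj[of _ _ 0 "Suc k"] graded_mult_0)
    then have "graded (Suc k) ([:of_nat p:] * a * b')" using graded_mult_0[of "Suc k" a' b] ab ab' by simp
    then have pa: "graded (Suc k) ([:of_nat p:] * a)" using graded_mult_cancel ab' by blast
    have "coeff a i \<in> I (k - i)" for i
    \<comment> \<open>For \<open>i > k\<close> truncated subtraction gives \<open>k - i = 0\<close>,
      so membership in \<open>I 0\<close> is the whole claim.\<close>
    proof (cases "i \<le> k")
      case True
      have "of_nat p * coeff a i \<in> I (Suc k - i)"
        using pa by (simp add: graded_def)
      then have "of_nat p * coeff a i \<in> I (Suc (k - i))" using True by (simp add: Suc_diff_le)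
      then show ?thesis using p_cancel graded_mem_0[OF ab(2)] by blast
    qed (simp add: graded_mem_0[OF ab(2)])
    then have "graded k a" by (simp add: graded_def)
    then show "x \<in> ?J k" using ab by blast
  next
    obtain T where T: "finite T" "\<And>x. x \<in> I 0 \<Longrightarrow> \<exists>t\<in>T. x - t \<in> I 1"
      using finite_residues by blast
    have "\<exists>u\<in>T. x - u \<in> ?J 1" if x: "x \<in> ?J 0" for x
    proof -
      obtain a b where ab: "x = poly a t / poly b t" "graded 0 a" "graded 0 b" "coeff b 0 = 1"
        using x by auto
      \<comment> \<open>The denominator has constant term 1 and the variable has weight one, so the
        constant term of the numerator determines the residue.\<close>
      obtain u where u: "u \<in> T" "coeff a 0 - u \<in> I 1" using T(2) graded_mem_0[OF ab(2)] by blast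
      have "u = coeff a 0 - (coeff a 0 - u)" by simp
      also have "\<dots> \<in> I 0"
        using diff_mem[OF graded_mem_0[OF ab(2), of 0] antimono_mem[OF u(2)]] by simp
      finally have "u \<in> I 0" .
      have "x - u = poly (a - [:u:] * b) t / poly b t"
        using nz[of b] ab by (simp add: field_simps)
      also have "\<dots> \<in> ?J 1"
      proof (intro J ab)
        have "graded 0 (a - [:u:] * b)"
          using ab \<open>u \<in> I 0\<close> by (intro graded_diff graded_mult_0 graded_const)
        then have "coeff (a - [:u:] * b) i \<in> I 0" for i by (rule graded_mem_0)
        moreover have "coeff (a - [:u:] * b) 0 \<in> I 1" using u ab by simp
        ultimately have "coeff (a - [:u:] * b) i \<in> I (1 - i)" for i
          by (cases i) auto
        then show "graded 1 (a - [:u:] * b)"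
          by (simp add: graded_def)
      qed
      finally show ?thesis using u by blast
    qed
    then show "\<exists>T. finite T \<and> (\<forall>x\<in>?J 0. \<exists>u\<in>T. x - u \<in> ?J 1)"
      using T(1) by blast
  qed (fact prime_p p_gt_2)+
qed

end

section \<open>Division by monic polynomials and algebraic extensions\<close>

text \<open>The divisor has coefficients in \<open>R\<close>, the dividend in an
  \<open>R\<close>-stable set \<open>J\<close>: this covers \<open>J = I k\<close> over
  \<open>I 0\<close> as well as a subfield in both roles. Bounding \<open>r\<close> by vanishing
  coefficients includes the case \<open>degree g = 0\<close>, where \<open>r = 0\<close>.\<close>

lemma monic_division:
  fixes g a :: "'a::comm_ring_1 poly"
  assumes monic: "lead_coeff g = 1" and g: "\<And>i. coeff g i \<in> R"
    and diff: "\<And>x y. x \<in> J \<Longrightarrow> y \<in> J \<Longrightarrow> x - y \<in> J" and zero: "0 \<in> J"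
    and mult: "\<And>x y. x \<in> R \<Longrightarrow> y \<in> J \<Longrightarrow> x * y \<in> J"
    and a: "\<And>i. coeff a i \<in> J"
  obtains q r where "a = g * q + r" "\<And>i. coeff q i \<in> J" "\<And>i. coeff r i \<in> J"
    "\<And>i. i \<ge> degree g \<Longrightarrow> coeff r i = 0"
proof -
  have "\<exists>q r. a = g * q + r \<and> (\<forall>i. coeff q i \<in> J) \<and> (\<forall>i. coeff r i \<in> J) \<and>
      (\<forall>i\<ge>degree g. coeff r i = 0)"
    if "\<forall>i. coeff a i \<in> J" "\<forall>i\<ge>n. coeff a i = 0" for n a
    using that
  proof (induction n arbitrary: a)
    case 0
    then have "a = 0" by (intro poly_eqI) simp
    then show ?case using zero by (intro exI[of _ 0]) auto
  next
    case (Suc n)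
    show ?case
    proof (cases "n < degree g")
      case True
      then show ?thesis using Suc.prems zero by (intro exI[of _ 0] exI[of _ a]) auto
    next
      case False
      define b where "b = a - monom (coeff a n) (n - degree g) * g"
      have coeff_b: "coeff b i = coeff a i - (if i < n - degree g then 0 else coeff g (i - (n - degree g)) * coeff a n)" for i
        unfolding b_def coeff_diff coeff_monom_mult by (simp add: mult.commute)
      have "\<forall>i. coeff b i \<in> J"
        unfolding coeff_b using Suc.prems by (auto intro!: diff mult g zero)
      moreover have "\<forall>i\<ge>n. coeff b i = 0"
      proof (intro allI impI)
        fix i assume "n \<le> i"
        show "coeff b i = 0"
        proof (cases "i = n")
          case True
          then show ?thesis using False monic by (simp add: coeff_b)
        next
          case i: False
          then have "coeff g (i - (n - degree g)) = 0" using \<open>n \<le> i\<close> False by (intro coeff_eq_0) simp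
          then show ?thesis using i \<open>n \<le> i\<close> Suc.prems by (simp add: coeff_b)
        qed
      qed
      ultimately obtain q r where qr: "b = g * q + r" "\<forall>i. coeff q i \<in> J" "\<forall>i. coeff r i \<in> J"
        "\<forall>i\<ge>degree g. coeff r i = 0"
        using Suc.IH by blast
      have "a = g * (monom (coeff a n) (n - degree g) + q) + r"
        using qr(1) by (simp add: b_def algebra_simps)
      moreover have "\<forall>i. coeff (monom (coeff a n) (n - degree g) + q) i \<in> J"
      proof
        fix i
        have "coeff q i \<in> J" "coeff a n \<in> J" using qr Suc.prems by auto
        \<comment> \<open>\<open>J\<close> is assumed closed under differences, so the sum is
          written as a double difference.\<close>
        moreover have "coeff a n - (0 - coeff q i) \<in> J"
          using \<open>coeff q i \<in> J\<close> \<open>coeff a n \<in> J\<close> by (intro diff zero)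
        ultimately show "coeff (monom (coeff a n) (n - degree g) + q) i \<in> J"
          by (auto simp: add.commute)
      qed
      ultimately show ?thesis using qr by blast
    qed
  qed
  moreover have "\<forall>i\<ge>Suc (degree a). coeff a i = 0" by (auto intro: coeff_eq_0)
  ultimately show thesis using a that by blast
qed

context padic_filtration
begin

lemma coeff_mult_mem:
  assumes "\<And>i. coeff a i \<in> I j" "\<And>i. coeff b i \<in> I k"
  shows "coeff (a * b) i \<in> I (j + k)"
  unfolding coeff_mult using assms by (intro sum_mem mult_mem)

text \<open>Reduction modulo the monic \<mu> preserves each level, and \<open>minimal\<close> makes
  the reduced representative unique. Separatedness, cancellation of \<open>p\<close> and residues
  are then handled coefficient by coefficient.\<close>

lemma algebraic_extension:
  assumes monic: "lead_coeff \<mu> = 1" and coeff_\<mu>: "\<And>i. coeff \<mu> i \<in> I 0" and root: "poly \<mu> t = 0"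
    and minimal: "\<And>q. (\<And>i. coeff q i \<in> I 0) \<Longrightarrow> (\<And>i. i \<ge> degree \<mu> \<Longrightarrow> coeff q i = 0) \<Longrightarrow> poly q t = 0 \<Longrightarrow> q = 0"
  shows "padic_filtration p (\<lambda>k. {poly a t | a. \<forall>i. coeff a i \<in> I k})"
    (is "padic_filtration p ?J")
proof -
  have reduce: "\<exists>a. x = poly a t \<and> (\<forall>i. coeff a i \<in> I k) \<and> (\<forall>i\<ge>degree \<mu>. coeff a i = 0)" if x: "x \<in> ?J k" for x k
  proof -
    obtain a where a: "x = poly a t" "\<And>i. coeff a i \<in> I k" using x by blast
    obtain q r where "a = \<mu> * q + r" "\<And>i. coeff r i \<in> I k" "\<And>i. i \<ge> degree \<mu> \<Longrightarrow> coeff r i = 0"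
      using monic_division[OF monic coeff_\<mu> diff_mem zero_mem mult_mem_left a(2)] by metis
    then show ?thesis using a root by (intro exI[of _ r]) auto
  qed
  have inj: "a = b" if "poly a t = poly b t" "\<forall>i. coeff a i \<in> I 0" "\<forall>i. coeff b i \<in> I 0"
    "\<forall>i\<ge>degree \<mu>. coeff a i = 0" "\<forall>i\<ge>degree \<mu>. coeff b i = 0" for a b
    using minimal[of "a - b"] that by (auto intro: diff_mem)
  show ?thesis
  proof
    show "1 \<in> ?J 0" using one_mem zero_mem by (intro CollectI exI[of _ 1]) auto
  next
    fix x y k
    assume "x \<in> ?J k" "y \<in> ?J k"
    then obtain a b where "x = poly a t" "y = poly b t" "\<forall>i. coeff a i \<in> I k" "\<forall>i. coeff b i \<in> I k"
      by blast
    then show "x - y \<in> ?J k" by (intro CollectI exI[of _ "a - b"]) (auto intro: diff_mem)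
  next
    fix x y j k
    assume "x \<in> ?J j" "y \<in> ?J k"
    then obtain a b where "x = poly a t" "y = poly b t" "\<forall>i. coeff a i \<in> I j" "\<forall>i. coeff b i \<in> I k"
      by blast
    then show "x * y \<in> ?J (j + k)" by (intro CollectI exI[of _ "a * b"]) (auto intro: coeff_mult_mem)
  next
    fix k
    show "?J (Suc k) \<subseteq> ?J k" using Suc_subset[of k] by blast
  next
    show "of_nat p \<in> ?J 1"
      using p_mem zero_mem by (intro CollectI exI[of _ "[:of_nat p:]"]) (auto simp: coeff_pCons split: nat.split)
  next
    fix x
    assume x: "\<And>k. x \<in> ?J k"
    obtain a where a: "x = poly a t" "\<forall>i. coeff a i \<in> I 0" "\<forall>i\<ge>degree \<mu>. coeff a i = 0"
      using reduce[OF x] by blast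
    have "coeff a i \<in> I k" for i k
    proof -
      obtain b where b: "x = poly b t" "\<forall>i. coeff b i \<in> I k" "\<forall>i\<ge>degree \<mu>. coeff b i = 0"
        using reduce[OF x] by blast
      have "a = b" using a b antimono_mem[of _ k 0] by (intro inj) auto
      then show ?thesis using b by simp
    qed
    then have "a = 0" using separated by (intro poly_eqI) simp
    then show "x = 0" using a by simp
  next
    fix x k
    assume x: "x \<in> ?J 0" and px: "of_nat p * x \<in> ?J (Suc k)"
    obtain a where a: "x = poly a t" "\<forall>i. coeff a i \<in> I 0" "\<forall>i\<ge>degree \<mu>. coeff a i = 0"
      using reduce[OF x] by blast
    obtain b where b: "of_nat p * x = poly b t" "\<forall>i. coeff b i \<in> I (Suc k)" "\<forall>i\<ge>degree \<mu>. coeff b i = 0"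
      using reduce[OF px] by blast
    have "smult (of_nat p) a = b"
      using a b antimono_mem[of _ "Suc k" 0] by (intro inj) (auto intro: mult_mem_left of_nat_mem)
    then have "of_nat p * coeff a i \<in> I (Suc k)" for i using b by auto
    then have "\<forall>i. coeff a i \<in> I k" using a p_cancel by blast
    then show "x \<in> ?J k" using a by blast
  next
    obtain T where T: "finite T" "\<And>x. x \<in> I 0 \<Longrightarrow> \<exists>t\<in>T. x - t \<in> I 1"
      using finite_residues by blast
    define U where "U = (\<lambda>c. \<Sum>i<degree \<mu>. c i * t ^ i) ` ({..<degree \<mu>} \<rightarrow>\<^sub>E T)"
    have "finite U" unfolding U_def using T(1) by (intro finite_imageI finite_PiE) auto
    moreover have "\<exists>u\<in>U. x - u \<in> ?J 1" if x: "x \<in> ?J 0" for x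
    proof -
      obtain a where a: "x = poly a t" "\<forall>i. coeff a i \<in> I 0" "\<forall>i\<ge>degree \<mu>. coeff a i = 0"
        using reduce[OF x] by blast
      obtain c where c: "\<And>i. c i \<in> T" "\<And>i. coeff a i - c i \<in> I 1"
      proof -
        have "\<forall>i. \<exists>u. u \<in> T \<and> coeff a i - u \<in> I 1" using T(2) a(2) by blast
        then show thesis using that by metis
      qed
      define b where "b = (\<Sum>i<degree \<mu>. monom (c i) i)"
      have "coeff b i = (if i < degree \<mu> then c i else 0)" for i
        by (simp add: b_def coeff_sum)
      then have diff: "\<forall>i. coeff (a - b) i \<in> I 1"
        using a(3) c(2) zero_mem by (auto simp: not_less)
      have "poly b t = (\<Sum>i<degree \<mu>. restrict c {..<degree \<mu>} i * t ^ i)"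
        by (simp add: b_def poly_sum poly_monom)
      moreover have "restrict c {..<degree \<mu>} \<in> {..<degree \<mu>} \<rightarrow>\<^sub>E T" using c(1) by auto
      ultimately have "poly b t \<in> U" unfolding U_def by (rule image_eqI)
      then show ?thesis using a diff by (intro bexI[of _ "poly b t"]) (auto intro!: exI[of _ "a - b"])
    qed
    ultimately show "\<exists>T. finite T \<and> (\<forall>x\<in>?J 0. \<exists>u\<in>T. x - u \<in> ?J 1)" by blast
  qed (fact prime_p p_gt_2)+
qed

end

section \<open>The \<open>p\<close>-adic filtration of the rationals\<close>

lemma rational_filtration:
  assumes p: "prime p" "2 < p"
  shows "padic_filtration p
    (\<lambda>k. {of_nat p ^ k * of_int a / of_int b | a b. \<not> int p dvd b} :: 'a::field_char_0 set)"
    (is "padic_filtration p ?J")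
proof -
  have J: "of_nat p ^ k * of_int a / of_int b \<in> ?J k" if "\<not> int p dvd b" for k a b
    using that by blast
  have pp: "prime (int p)" using p by simp
  have p_dvd_iff: "int p dvd b * b' \<longleftrightarrow> int p dvd b \<or> int p dvd b'" for b b'
    using pp by (rule prime_dvd_mult_iff)
  have nz: "of_int b \<noteq> (0 :: 'a)" if "\<not> int p dvd b" for b using that by auto
  show ?thesis
  proof
    show "1 \<in> ?J 0" using J[of 1 0 1] p by simp
  next
    fix x y k
    assume "x \<in> ?J k" "y \<in> ?J k"
    then obtain a b a' b' where x: "x = of_nat p ^ k * of_int a / of_int b" "\<not> int p dvd b"
      and y: "y = of_nat p ^ k * of_int a' / of_int b'" "\<not> int p dvd b'"
      by auto
    have "x - y = of_nat p ^ k * of_int (a * b' - a' * b) / of_int (b * b')"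
      using nz[OF x(2)] nz[OF y(2)] unfolding x(1) y(1) by (simp add: field_simps)
    also have "\<dots> \<in> ?J k" using x y by (intro J) (simp add: p_dvd_iff)
    finally show "x - y \<in> ?J k" .
  next
    fix x y j k
    assume "x \<in> ?J j" "y \<in> ?J k"
    then obtain a b a' b' where x: "x = of_nat p ^ j * of_int a / of_int b" "\<not> int p dvd b"
      and y: "y = of_nat p ^ k * of_int a' / of_int b'" "\<not> int p dvd b'"
      by auto
    have "x * y = of_nat p ^ (j + k) * of_int (a * a') / of_int (b * b')"
      unfolding x(1) y(1) by (simp add: power_add)
    also have "\<dots> \<in> ?J (j + k)" using x y by (intro J) (simp add: p_dvd_iff)
    finally show "x * y \<in> ?J (j + k)" .
  next
    fix k
    have "of_nat p ^ Suc k * of_int a / of_int b \<in> ?J k" if "\<not> int p dvd b" for a b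
      using J[OF that, of k "int p * a"] by (simp add: mult_ac)
    then show "?J (Suc k) \<subseteq> ?J k" by auto
  next
    show "of_nat p \<in> ?J 1" using J[of 1 1 1] p by simp
  next
    fix x
    assume x: "\<And>k. x \<in> ?J k"
    obtain a b where ab: "x = of_int a / of_int b" "\<not> int p dvd b" using x[of 0] by auto
    have dvd: "int p ^ k dvd a" for k
    proof -
      obtain a' b' where ab': "x = of_nat p ^ k * of_int a' / of_int b'" "\<not> int p dvd b'" using x[of k] by auto
      have "of_int (a * b') = (of_int (int p ^ k * a' * b) :: 'a)"
        using ab ab' nz by (simp add: field_simps)
      then have "a * b' = int p ^ k * a' * b" by (simp only: of_int_eq_iff)
      then have "int p ^ k dvd a * b'" by (metis dvd_triv_left mult.assoc)
      moreover have "coprime (int p ^ k) b'"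
        using prime_imp_coprime[OF pp ab'(2)] by simp
      ultimately show ?thesis by (simp add: coprime_dvd_mult_left_iff)
    qed
    \<comment> \<open>A nonzero \<open>a\<close> would be divisible by
      \<open>p ^ nat \<bar>a\<bar>\<close>, which exceeds its absolute value.\<close>
    have "a = 0"
    proof (rule ccontr)
      assume "a \<noteq> 0"
      then have "int p ^ nat \<bar>a\<bar> \<le> \<bar>a\<bar>" using dvd_imp_le_int[OF _ dvd] by simp
      moreover have "nat \<bar>a\<bar> < p ^ nat \<bar>a\<bar>" using p by (intro power_gt_expt) simp
      then have "int (nat \<bar>a\<bar>) < int p ^ nat \<bar>a\<bar>" by (metis of_nat_less_iff of_nat_power)
      ultimately show False by simp
    qed
    then show "x = 0" using ab by simp
  next
    fix x k
    assume "of_nat p * x \<in> ?J (Suc k)"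
    then obtain a b where ab: "of_nat p * x = of_nat p ^ Suc k * of_int a / of_int b" "\<not> int p dvd b"
      by auto
    then have "x = of_nat p ^ k * of_int a / of_int b"
      using p by (simp add: mult.assoc flip: times_divide_eq_right)
    then show "x \<in> ?J k" using ab J by blast
  next
    have "\<exists>u\<in>of_int ` {0..<int p}. x - u \<in> ?J 1" if x: "x \<in> ?J 0" for x
    proof -
      obtain a b where ab: "x = of_int a / of_int b" "\<not> int p dvd b" using x by auto
      have "coprime b (int p)" using prime_imp_coprime[OF pp ab(2)] by (simp add: coprime_commute)
      then obtain u v where uv: "u * b + v * int p = 1"
        by (metis bezout_int coprime_imp_gcd_eq_1)
      \<comment> \<open>\<open>u\<close> inverts \<open>b\<close> modulo \<open>p\<close>, so
        \<open>r\<close> is the residue of the fraction \<open>a / b\<close>.\<close>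
      define r where "r = (u * a) mod int p"
      have "a = (u * a) * b + int p * (v * a)"
        using arg_cong[OF uv, of "\<lambda>z. z * a"] by (simp add: algebra_simps)
      also have "u * a = int p * (u * a div int p) + r" by (simp add: r_def)
      finally obtain w where w: "a = int p * w + r * b"
        using that[of "(u * a div int p) * b + v * a"] by (simp add: algebra_simps)
      have "x - of_int r = of_nat p ^ 1 * of_int w / of_int b"
        using nz[OF ab(2)] unfolding ab(1) w by (simp add: field_simps)
      then have "x - of_int r \<in> ?J 1" using J[OF ab(2), of 1 w] by simp
      moreover have "r \<in> {0..<int p}" using p by (simp add: r_def)
      ultimately show ?thesis by blast
    qed
    then show "\<exists>T. finite T \<and> (\<forall>x\<in>?J 0. \<exists>u\<in>T. x - u \<in> ?J 1)"
      by (intro exI[of _ "of_int ` {0..<int p}"]) auto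
  qed (fact p)+
qed

section \<open>Subfields and adjunction of one element\<close>

locale subfield =
  fixes L :: "'a::field_char_0 set"
  assumes one_closed: "1 \<in> L"
    and diff_closed: "x \<in> L \<Longrightarrow> y \<in> L \<Longrightarrow> x - y \<in> L"
    and mult_closed: "x \<in> L \<Longrightarrow> y \<in> L \<Longrightarrow> x * y \<in> L"
    and inverse_closed: "x \<in> L \<Longrightarrow> inverse x \<in> L"
begin

lemma zero_closed: "0 \<in> L"
  using diff_closed[OF one_closed one_closed] by simp

lemma uminus_closed: "x \<in> L \<Longrightarrow> - x \<in> L"
  using diff_closed[OF zero_closed] by simp

lemma add_closed: "x \<in> L \<Longrightarrow> y \<in> L \<Longrightarrow> x + y \<in> L"
  using diff_closed[of x "- y"] uminus_closed by simp

lemma sum_closed: "(\<And>i. i \<in> A \<Longrightarrow> f i \<in> L) \<Longrightarrow> sum f A \<in> L"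
  by (induction A rule: infinite_finite_induct) (auto simp: zero_closed add_closed)

lemma of_nat_closed: "of_nat n \<in> L"
  by (induction n) (auto simp: zero_closed add_closed one_closed)

definition polys :: "'a poly set" where
  "polys = {q. \<forall>i. coeff q i \<in> L}"

lemma polys_const: "c \<in> L \<Longrightarrow> [:c:] \<in> polys"
  unfolding polys_def by (auto simp: coeff_pCons zero_closed split: nat.split)

lemma polys_0: "0 \<in> polys" and polys_1: "1 \<in> polys"
  unfolding polys_def by (auto simp: zero_closed one_closed)

lemma polys_diff: "a \<in> polys \<Longrightarrow> b \<in> polys \<Longrightarrow> a - b \<in> polys"
  unfolding polys_def by (auto intro: diff_closed)

lemma polys_add: "a \<in> polys \<Longrightarrow> b \<in> polys \<Longrightarrow> a + b \<in> polys"
  unfolding polys_def by (auto intro: add_closed)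

lemma polys_mult: "a \<in> polys \<Longrightarrow> b \<in> polys \<Longrightarrow> a * b \<in> polys"
  unfolding polys_def by (auto simp: coeff_mult intro!: sum_closed mult_closed)

lemma polys_smult: "c \<in> L \<Longrightarrow> a \<in> polys \<Longrightarrow> smult c a \<in> polys"
  unfolding polys_def by (auto intro: mult_closed)

lemma polys_linear: "c \<in> L \<Longrightarrow> [:c, 1:] \<in> polys"
  unfolding polys_def by (auto simp: coeff_pCons zero_closed one_closed split: nat.split)

lemma polys_pcompose: "a \<in> polys \<Longrightarrow> b \<in> polys \<Longrightarrow> pcompose a b \<in> polys"
proof (induction a)
  case (pCons c a)
  have "c \<in> L" "a \<in> polys"
    using pCons.prems(1) unfolding polys_def by (auto simp: coeff_pCons split: nat.splits)
  with pCons show ?case by (auto simp: pcompose_pCons intro!: polys_add polys_mult polys_const)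
qed (simp add: polys_0)

lemma poly_closed: "a \<in> polys \<Longrightarrow> x \<in> L \<Longrightarrow> poly a x \<in> L"
  unfolding polys_def poly_altdef
  by (auto intro!: sum_closed mult_closed) (induct_tac i, auto intro: one_closed mult_closed)

definition adjoin :: "'a \<Rightarrow> 'a set" where
  "adjoin t = {poly a t / poly b t | a b. a \<in> polys \<and> b \<in> polys}"

lemma adjoinE:
  assumes "x \<in> adjoin t"
  obtains a b where "x = poly a t / poly b t" "a \<in> polys" "b \<in> polys" "poly b t \<noteq> 0"
proof -
  obtain a b where ab: "x = poly a t / poly b t" "a \<in> polys" "b \<in> polys"
    using assms unfolding adjoin_def by blast
  show thesis
  proof (cases "poly b t = 0")
    case True
    then show thesis using that[of 0 1] ab by (simp add: polys_0 polys_1)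
  qed (use that ab in blast)
qed

lemma adjoinI: "a \<in> polys \<Longrightarrow> b \<in> polys \<Longrightarrow> poly a t / poly b t \<in> adjoin t"
  unfolding adjoin_def by blast

lemma poly_mem_adjoin: "a \<in> polys \<Longrightarrow> poly a t \<in> adjoin t"
  using adjoinI[of a 1 t] by (simp add: polys_1)

lemma subset_adjoin: "L \<subseteq> adjoin t"
  using poly_mem_adjoin[OF polys_const] by auto

lemma mem_adjoin: "t \<in> adjoin t"
  using poly_mem_adjoin[OF polys_linear[OF zero_closed], of t] by simp

lemma subfield_adjoin: "subfield (adjoin t)"
proof
  show "1 \<in> adjoin t" using subset_adjoin one_closed by blast
next
  fix x y assume "x \<in> adjoin t" "y \<in> adjoin t"
  then obtain a b a' b' where x: "x = poly a t / poly b t" "a \<in> polys" "b \<in> polys" "poly b t \<noteq> 0"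
    and y: "y = poly a' t / poly b' t" "a' \<in> polys" "b' \<in> polys" "poly b' t \<noteq> 0"
    by (metis adjoinE)
  have "x - y = poly (a * b' - a' * b) t / poly (b * b') t"
    using x(4) y(4) unfolding x(1) y(1) by (simp add: field_simps)
  then show "x - y \<in> adjoin t" using x y by (simp only:) (intro adjoinI polys_diff polys_mult)
  have "x * y = poly (a * a') t / poly (b * b') t" using x y by simp
  then show "x * y \<in> adjoin t" using x y by (simp only:) (intro adjoinI polys_mult)
next
  fix x assume "x \<in> adjoin t"
  then obtain a b where x: "x = poly a t / poly b t" "a \<in> polys" "b \<in> polys" by (metis adjoinE)
  then have "inverse x = poly b t / poly a t" by simp
  then show "inverse x \<in> adjoin t" using adjoinI x by simp
qed

end

section \<open>Filtrations on simple extensions\<close>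

text \<open>
  This property passes to simple extensions, and it is only tested on finite subsets, so it
  may be proved by adjoining one element at a time.
\<close>

definition admits_filtrations :: "'a::field_char_0 set \<Rightarrow> bool" where
  "admits_filtrations L \<longleftrightarrow>
    (\<forall>S. finite S \<longrightarrow> S \<subseteq> L \<longrightarrow> (\<exists>p I. padic_filtration p I \<and> S \<subseteq> I 0 \<and> I 0 \<subseteq> L))"

lemma finite_range_coeff: "finite (range (coeff (q :: 'a::zero poly)))"
  by (simp add: range_coeff)

context subfield
begin

text \<open>Translating the variable by a natural number that is no root of the denominators makes
  their constant terms nonzero, and scaling makes them 1. The coefficients obtained form a finite
  subset of \<open>L\<close>, whose filtration is then extended.\<close>

lemma admits_filtrations_transcendental:
  assumes L: "admits_filtrations L"
    and transcendental: "\<And>q. q \<in> polys \<Longrightarrow> poly q t = 0 \<Longrightarrow> q = 0"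
  shows "admits_filtrations (adjoin t)"
  unfolding admits_filtrations_def
proof (intro allI impI)
  fix S assume S: "finite S" "S \<subseteq> adjoin t"
  then have "\<forall>s\<in>S. \<exists>a b. s = poly a t / poly b t \<and> a \<in> polys \<and> b \<in> polys \<and> poly b t \<noteq> 0"
    by (metis adjoinE subsetD)
  then obtain a b where ab: "\<And>s. s \<in> S \<Longrightarrow> s = poly (a s) t / poly (b s) t"
    "\<And>s. s \<in> S \<Longrightarrow> a s \<in> polys" "\<And>s. s \<in> S \<Longrightarrow> b s \<in> polys" "\<And>s. s \<in> S \<Longrightarrow> poly (b s) t \<noteq> 0"
    by metis
  have "b s \<noteq> 0" if "s \<in> S" for s using ab(4)[OF that] by auto
  then have "(\<Prod>s\<in>S. b s) \<noteq> 0" using S(1) by auto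
  then have "finite {x. poly (\<Prod>s\<in>S. b s) x = 0}" by (rule poly_roots_finite)
  \<comment> \<open>In characteristic zero the natural numbers form an infinite set, so some
    \<open>n\<close> avoids the roots.\<close>
  then have "\<not> range of_nat \<subseteq> {x. poly (\<Prod>s\<in>S. b s) x = 0}"
    using finite_subset infinite_UNIV_char_0 finite_imageD[of "of_nat :: nat \<Rightarrow> 'a" UNIV]
    by (metis infinite_UNIV_nat inj_of_nat)
  then obtain n where n: "poly (\<Prod>s\<in>S. b s) (of_nat n) \<noteq> 0" by blast
  define u where "u = t - of_nat n"
  \<comment> \<open>Numerator and denominator of \<open>s\<close> are scaled alike, so the quotient
    is unchanged while the denominator gets constant term 1.\<close>
  define shift where "shift = (\<lambda>s c. smult (inverse (poly (b s) (of_nat n))) (pcompose c [:of_nat n, 1:]))"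
  have bn: "poly (b s) (of_nat n) \<noteq> 0" if "s \<in> S" for s
    using n that S(1) by (auto simp: poly_prod)
  have shift_polys: "shift s c \<in> polys" if "s \<in> S" "c \<in> polys" for s c
    unfolding shift_def using that ab
    by (intro polys_smult inverse_closed poly_closed polys_pcompose polys_linear of_nat_closed) auto
  have poly_shift: "poly (shift s c) u = inverse (poly (b s) (of_nat n)) * poly c t" for s c
    by (simp add: shift_def poly_pcompose u_def)
  define S' where "S' = (\<Union>s\<in>S. range (coeff (shift s (a s))) \<union> range (coeff (shift s (b s))))"
  have "finite S'" unfolding S'_def using S(1) by (intro finite_UN_I finite_UnI finite_range_coeff)
  moreover have "S' \<subseteq> L"
    unfolding S'_def using shift_polys ab by (auto simp: polys_def)
  ultimately obtain p I where I: "padic_filtration p I" "S' \<subseteq> I 0" "I 0 \<subseteq> L"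
    using L unfolding admits_filtrations_def by blast
  interpret padic_filtration p I by (rule I)
  define J where "J = (\<lambda>k. {poly a u / poly b u | a b. graded k a \<and> graded 0 b \<and> coeff b 0 = 1})"
  have "padic_filtration p J"
    unfolding J_def
  proof (rule transcendental_extension)
    fix q assume q: "\<And>i. coeff q i \<in> I 0" "poly q u = 0"
    \<comment> \<open>\<open>I 0 \<subseteq> L\<close> puts \<open>q\<close> over \<open>L\<close>;
      translating by \<open>n\<close> turns a relation for \<open>u\<close> into one for
      \<open>t\<close>.\<close>
    have "q \<in> polys" using q I by (auto simp: polys_def)
    then have "pcompose q [:- of_nat n, 1:] = 0"
      using q by (intro transcendental polys_pcompose polys_linear uminus_closed of_nat_closed)
        (auto simp: poly_pcompose u_def)
    then show "q = 0" by (simp add: pcompose_eq_0_iff)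
  qed
  moreover have "S \<subseteq> J 0"
  proof
    fix s assume s: "s \<in> S"
    have "s = poly (shift s (a s)) u / poly (shift s (b s)) u"
      using ab(1,4)[OF s] bn[OF s] by (simp add: poly_shift)
    moreover have "range (coeff (shift s (a s))) \<subseteq> I 0" "range (coeff (shift s (b s))) \<subseteq> I 0"
      using I(2) s unfolding S'_def by blast+
    then have "graded 0 (shift s (a s))" "graded 0 (shift s (b s))"
      by (auto simp: graded_def)
    moreover have "coeff (shift s (b s)) 0 = 1"
      using bn[OF s] by (simp add: shift_def poly_pcompose flip: poly_0_coeff_0)
    ultimately show "s \<in> J 0" unfolding J_def by blast
  qed
  moreover have "J 0 \<subseteq> adjoin t"
  proof
    fix x assume "x \<in> J 0"
    then obtain a b where x: "x = poly a u / poly b u" "graded 0 a" "graded 0 b"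
      unfolding J_def by blast
    have "poly c u \<in> adjoin t" if "graded 0 c" for c
    proof -
      have "c \<in> polys" using that I(3) by (auto simp: polys_def graded_def)
      then have "pcompose c [:- of_nat n, 1:] \<in> polys"
        by (intro polys_pcompose polys_linear uminus_closed of_nat_closed)
      from poly_mem_adjoin[OF this, of t] show ?thesis by (simp add: poly_pcompose u_def)
    qed
    then have "poly a u * inverse (poly b u) \<in> adjoin t"
      using x by (intro subfield.mult_closed[OF subfield_adjoin] subfield.inverse_closed[OF subfield_adjoin])
    then show "x \<in> adjoin t" using x by (simp add: divide_inverse)
  qed
  ultimately show "\<exists>p I. padic_filtration p I \<and> S \<subseteq> I 0 \<and> I 0 \<subseteq> adjoin t" by blast
qed

text \<open>A nonzero candidate of least degree is scaled to be monic. \<open>Q\<close> is abstract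
  because it is used both for vanishing at \<open>t\<close> and for the ideal in
  \<open>inverse_mem_polynomials\<close>.\<close>

lemma minimal_polynomial:
  assumes "q \<in> polys" "q \<noteq> 0" "Q q" and smult: "\<And>c q. c \<in> L \<Longrightarrow> c \<noteq> 0 \<Longrightarrow> Q q \<Longrightarrow> Q (smult c q)"
  obtains \<mu> where "\<mu> \<in> polys" "lead_coeff \<mu> = 1" "Q \<mu>"
    "\<And>r. r \<in> polys \<Longrightarrow> Q r \<Longrightarrow> (\<And>i. i \<ge> degree \<mu> \<Longrightarrow> coeff r i = 0) \<Longrightarrow> r = 0"
proof -
  obtain m where m: "m \<in> polys \<and> m \<noteq> 0 \<and> Q m" "\<And>r. r \<in> polys \<and> r \<noteq> 0 \<and> Q r \<Longrightarrow> degree m \<le> degree r"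
    using ex_has_least_nat[of "\<lambda>r. r \<in> polys \<and> r \<noteq> 0 \<and> Q r" q degree] assms by blast
  define \<mu> where "\<mu> = smult (inverse (lead_coeff m)) m"
  have lc: "lead_coeff m \<in> L" "lead_coeff m \<noteq> 0" using m by (auto simp: polys_def)
  show thesis
  proof (rule that)
    show "\<mu> \<in> polys" "lead_coeff \<mu> = 1" "Q \<mu>"
      unfolding \<mu>_def using lc m(1) by (auto intro: polys_smult smult inverse_closed)
  next
    fix r assume r: "r \<in> polys" "Q r" "\<And>i. i \<ge> degree \<mu> \<Longrightarrow> coeff r i = 0"
    show "r = 0"
    proof (rule ccontr)
      assume "r \<noteq> 0"
      then have "degree m \<le> degree r" using m r by blast
      then have "coeff r (degree r) = 0" using r(3) lc by (simp add: \<mu>_def)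
      with \<open>r \<noteq> 0\<close> show False by simp
    qed
  qed
qed

lemma polys_division:
  assumes "g \<in> polys" "lead_coeff g = 1" "a \<in> polys"
  obtains q r where "a = g * q + r" "q \<in> polys" "r \<in> polys" "\<And>i. i \<ge> degree g \<Longrightarrow> coeff r i = 0"
  using monic_division[of g L L a] assms diff_closed zero_closed mult_closed unfolding polys_def by auto

text \<open>A Bezout argument in the ideal of polynomials whose value at \<open>t\<close> is a
  polynomial multiple of \<open>poly b t\<close>. Its monic element \<open>g\<close> of least degree
  divides \<mu>; since \<open>poly g t \<noteq> 0\<close>, the cofactor vanishes at
  \<open>t\<close>, and minimality of \<mu> forces \<open>g = 1\<close>.\<close>

lemma inverse_mem_polynomials:
  assumes \<mu>: "\<mu> \<in> polys" "lead_coeff \<mu> = 1" "poly \<mu> t = 0"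
    and minimal: "\<And>r. r \<in> polys \<Longrightarrow> poly r t = 0 \<Longrightarrow> (\<And>i. i \<ge> degree \<mu> \<Longrightarrow> coeff r i = 0) \<Longrightarrow> r = 0"
    and b: "b \<in> polys" "poly b t \<noteq> 0"
  obtains c where "c \<in> polys" "poly c t * poly b t = 1"
proof -
  define Q where "Q = (\<lambda>g. \<exists>u\<in>polys. poly g t = poly u t * poly b t)"
  have "Q b" unfolding Q_def using polys_1 by (intro bexI[of _ 1]) auto
  moreover have "b \<noteq> 0" using b by auto
  moreover have "Q (smult c g)" if "c \<in> L" "Q g" for c g
  proof -
    obtain u where "u \<in> polys" "poly g t = poly u t * poly b t"
      using \<open>Q g\<close> unfolding Q_def by blast
    then show ?thesis unfolding Q_def using that by (intro bexI[of _ "smult c u"] polys_smult) auto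
  qed
  ultimately obtain g where g: "g \<in> polys" "lead_coeff g = 1" "Q g"
    and g_min: "\<And>r. r \<in> polys \<Longrightarrow> Q r \<Longrightarrow> (\<And>i. i \<ge> degree g \<Longrightarrow> coeff r i = 0) \<Longrightarrow> r = 0"
    using minimal_polynomial[of b Q] b by metis
  obtain u where u: "u \<in> polys" "poly g t = poly u t * poly b t" using g(3) unfolding Q_def by blast
  obtain q r where qr: "\<mu> = g * q + r" "q \<in> polys" "r \<in> polys" "\<And>i. i \<ge> degree g \<Longrightarrow> coeff r i = 0"
    using polys_division[OF g(1,2) \<mu>(1)] by blast
  have "poly r t = poly (- (u * q)) t * poly b t"
    using arg_cong[OF qr(1), of "\<lambda>z. poly z t"] u \<mu>(3) by (simp add: eq_neg_iff_add_eq_0 algebra_simps)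
  moreover have "0 - u * q \<in> polys" using u qr by (intro polys_diff polys_0 polys_mult)
  then have "- (u * q) \<in> polys" by simp
  ultimately have "Q r" unfolding Q_def by blast
  then have "r = 0" using g_min qr by blast
  then have \<mu>_eq: "\<mu> = g * q" using qr by simp
  have "g \<noteq> 0" "q \<noteq> 0" using \<mu>(2) \<mu>_eq by auto
  then have deg: "degree \<mu> = degree g + degree q" unfolding \<mu>_eq by (rule degree_mult_eq)
  \<comment> \<open>The remainder of \<open>b\<close> modulo \<mu> is a nonzero element of the
    ideal, so \<open>g\<close> has smaller degree than \<mu> and cannot vanish at
    \<open>t\<close>.\<close>
  have "poly g t \<noteq> 0"
  proof
    assume g0: "poly g t = 0"
    obtain q' r' where r': "b = \<mu> * q' + r'" "r' \<in> polys" "\<And>i. i \<ge> degree \<mu> \<Longrightarrow> coeff r' i = 0"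
      using polys_division[OF \<mu>(1,2) b(1)] by blast
    have "poly r' t = poly b t" using r' \<mu>(3) by simp
    then have "Q r'" "r' \<noteq> 0" using b unfolding Q_def by (auto intro: bexI[of _ 1] polys_1)
    then have "\<not> (\<forall>i\<ge>degree g. coeff r' i = 0)" using g_min r' by blast
    then have "degree g < degree \<mu>" using r'(3) by (metis leI le_trans)
    then have "coeff g i = 0" if "i \<ge> degree \<mu>" for i using that by (intro coeff_eq_0) simp
    then have "g = 0" by (rule minimal[OF g(1) g0])
    with \<open>g \<noteq> 0\<close> show False by simp
  qed
  then have "poly q t = 0" using \<mu>(3) \<mu>_eq by simp
  then have "\<not> degree q < degree \<mu>"
    using minimal[OF qr(2)] \<open>q \<noteq> 0\<close> by (meson coeff_eq_0 order_less_le_trans)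
  then have "degree g = 0" using deg by simp
  then have "g = 1" using g(2) by (metis degree_0_id lead_coeff_pCons(1) one_pCons degree_eq_zeroE pCons_0_0 coeff_pCons_0)
  then show thesis using that[of u] u by simp
qed

text \<open>Inverses of polynomial values are again polynomial values, so each element of
  \<open>S\<close> has the form \<open>poly a t\<close>. The coefficients of \<mu> join the finite
  set to make \<mu> a polynomial over \<open>I 0\<close>.\<close>

lemma admits_filtrations_algebraic:
  assumes L: "admits_filtrations L" and algebraic: "q \<in> polys" "q \<noteq> 0" "poly q t = 0"
  shows "admits_filtrations (adjoin t)"
  unfolding admits_filtrations_def
proof (intro allI impI)
  fix S assume S: "finite S" "S \<subseteq> adjoin t"
  obtain \<mu> where \<mu>: "\<mu> \<in> polys" "lead_coeff \<mu> = 1" "poly \<mu> t = 0"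
    and minimal: "\<And>r. r \<in> polys \<Longrightarrow> poly r t = 0 \<Longrightarrow> (\<And>i. i \<ge> degree \<mu> \<Longrightarrow> coeff r i = 0) \<Longrightarrow> r = 0"
    using minimal_polynomial[of q "\<lambda>q. poly q t = 0"] algebraic by (metis mult_zero_right poly_smult)
  have "\<forall>s\<in>S. \<exists>a. s = poly a t \<and> a \<in> polys"
  proof
    fix s assume "s \<in> S"
    then obtain a b where ab: "s = poly a t / poly b t" "a \<in> polys" "b \<in> polys" "poly b t \<noteq> 0"
      using S adjoinE by blast
    obtain c where c: "c \<in> polys" "poly c t * poly b t = 1"
      using inverse_mem_polynomials[OF \<mu> minimal ab(3,4)] by blast
    have "poly c t = inverse (poly b t)" using c(2) inverse_unique by (metis mult.commute)
    then have "s = poly (a * c) t" using ab(1) by (simp add: divide_inverse)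
    then show "\<exists>a. s = poly a t \<and> a \<in> polys" using polys_mult ab c by blast
  qed
  then obtain a where a: "\<And>s. s \<in> S \<Longrightarrow> s = poly (a s) t" "\<And>s. s \<in> S \<Longrightarrow> a s \<in> polys" by metis
  define S' where "S' = range (coeff \<mu>) \<union> (\<Union>s\<in>S. range (coeff (a s)))"
  have "finite S'" unfolding S'_def using S(1) by (intro finite_UN_I finite_UnI finite_range_coeff)
  moreover have "S' \<subseteq> L" unfolding S'_def using \<mu>(1) a(2) by (auto simp: polys_def)
  ultimately obtain p I where I: "padic_filtration p I" "S' \<subseteq> I 0" "I 0 \<subseteq> L"
    using L unfolding admits_filtrations_def by blast
  interpret padic_filtration p I by (rule I)
  define J where "J = (\<lambda>k. {poly a t | a. \<forall>i. coeff a i \<in> I k})"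
  have "padic_filtration p J"
    unfolding J_def
  proof (rule algebraic_extension)
    fix r assume "\<And>i. coeff r i \<in> I 0" "\<And>i. i \<ge> degree \<mu> \<Longrightarrow> coeff r i = 0" "poly r t = 0"
    then show "r = 0" using I(3) by (intro minimal) (auto simp: polys_def)
  qed (use \<mu> I(2) in \<open>auto simp: S'_def\<close>)
  moreover have "S \<subseteq> J 0"
    using a(1) I(2) unfolding J_def S'_def by blast
  moreover have "J 0 \<subseteq> adjoin t"
    using I(3) poly_mem_adjoin unfolding J_def polys_def by blast
  ultimately show "\<exists>p I. padic_filtration p I \<and> S \<subseteq> I 0 \<and> I 0 \<subseteq> adjoin t" by blast
qed

lemma admits_filtrations_adjoin: "admits_filtrations L \<Longrightarrow> admits_filtrations (adjoin t)"
  using admits_filtrations_transcendental admits_filtrations_algebraic by blast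

end

lemma subfield_Rats: "subfield (\<rat> :: 'a::field_char_0 set)"
  by unfold_locales auto

text \<open>A prime above 2 and above all denominators divides none of them.\<close>

lemma admits_filtrations_Rats: "admits_filtrations (\<rat> :: 'a::field_char_0 set)"
  unfolding admits_filtrations_def
proof (intro allI impI)
  fix S :: "'a set" assume S: "finite S" "S \<subseteq> \<rat>"
  then have "\<forall>s\<in>S. \<exists>a b. b > 0 \<and> s = of_int a / of_int b"
    by (metis Rats_cases' subsetD)
  then obtain a b where ab: "\<And>s. s \<in> S \<Longrightarrow> b s > 0" "\<And>s. s \<in> S \<Longrightarrow> s = of_int (a s) / of_int (b s)"
    by metis
  obtain p where p: "prime p" "p > Max (insert 2 (nat ` b ` S))"
    using bigger_prime by blast
  have "2 < p" and b_less: "nat (b s) < p" if "s \<in> S" for s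
    using p(2) S(1) that by auto
  have "2 < p" using p(2) S(1) by auto
  define J where "J = (\<lambda>k. {of_nat p ^ k * of_int a / of_int b | a b. \<not> int p dvd b} :: 'a set)"
  have "padic_filtration p J" unfolding J_def using p(1) \<open>2 < p\<close> by (rule rational_filtration)
  moreover have "S \<subseteq> J 0"
  proof
    fix s assume s: "s \<in> S"
    have "\<not> int p dvd b s" using ab(1)[OF s] b_less[OF s] by (intro zdvd_not_zless) auto
    then show "s \<in> J 0" unfolding J_def using ab(2)[OF s] by auto
  qed
  moreover have "J 0 \<subseteq> \<rat>" unfolding J_def by auto
  ultimately show "\<exists>p I. padic_filtration p I \<and> S \<subseteq> I 0 \<and> I 0 \<subseteq> \<rat>" by blast
qed

lemma ex_padic_filtration:
  fixes S :: "'a::field_char_0 set"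
  assumes "finite S"
  shows "\<exists>p I. padic_filtration p I \<and> S \<subseteq> I 0"
proof -
  have "\<exists>L. subfield L \<and> admits_filtrations L \<and> S \<subseteq> L"
    using assms
  proof (induction S rule: finite_induct)
    case empty
    then show ?case using subfield_Rats admits_filtrations_Rats by blast
  next
    case (insert t S)
    then obtain L where L: "subfield L" "admits_filtrations L" "S \<subseteq> L" by blast
    interpret subfield L by (rule L)
    have "insert t S \<subseteq> adjoin t" using L(3) subset_adjoin[of t] mem_adjoin[of t] by auto
    with subfield_adjoin[of t] admits_filtrations_adjoin[OF L(2), of t] show ?case by blast
  qed
  then obtain L where "admits_filtrations L" "S \<subseteq> L" by blast
  then have "\<exists>p I. padic_filtration p I \<and> S \<subseteq> I 0 \<and> I 0 \<subseteq> L"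
    using assms by (simp add: admits_filtrations_def)
  then show ?thesis by blast
qed

section \<open>Zero sets\<close>

theorem theorem1p2:
  fixes d :: nat
    and P :: "nat \<Rightarrow> 'a::field_char_0 poly"
    and f :: "nat \<Rightarrow> 'a"
  assumes "d > 0"
    and "degree (P d) = 0" and "P d \<noteq> 0"
    and "\<exists>N\<ge>d. \<forall>n\<ge>N. f n = (\<Sum>i = 1..d. poly (P i) (of_nat n) * f (n - i))"
  shows "\<exists>\<A> F. finite \<A> \<and> (\<forall>A\<in>\<A>. arithmetic_progression A) \<and> finite F \<and>
           {n. f n = 0} = \<Union>\<A> \<union> F"
proof -
  obtain N where N: "N \<ge> d" "\<And>n. n \<ge> N \<Longrightarrow> f n = (\<Sum>i = 1..d. poly (P i) (of_nat n) * f (n - i))"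
    using assms(4) by blast
  obtain c where c: "P d = [:c:]" "c \<noteq> 0"
    using assms(2,3) by (metis degree_eq_zeroE pCons_0_0)
  \<comment> \<open>With this shift \<open>g (n + d)\<close> is \<open>f (n + N)\<close>, so the
    recurrence holds for \<open>g\<close> from \<open>n = 0\<close> on.\<close>
  define M where "M = N - d"
  define g where "g = (\<lambda>n. f (n + M))"
  \<comment> \<open>Read upwards, the recurrence has \<open>P (d - j)\<close> at index
    \<open>j\<close>, evaluated at \<open>n + N\<close>. The default 0 keeps the coefficients in
    \<open>I 0\<close> for every \<open>j\<close>.\<close>
  define Q where "Q = (\<lambda>j. if j < d then pcompose (P (d - j)) [:of_nat N, 1:] else 0)"
  have rec: "g (n + d) = (\<Sum>j<d. poly (Q j) (of_nat n) * g (n + j))" for n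
  proof -
    have "g (n + d) = (\<Sum>i = 1..d. poly (P i) (of_nat (n + N)) * f (n + N - i))"
      using N(1) N(2)[of "n + N"] by (simp add: g_def M_def)
    also have "\<dots> = (\<Sum>j<d. poly (Q j) (of_nat n) * g (n + j))"
    proof (rule sum.reindex_bij_witness[of _ "\<lambda>j. d - j" "\<lambda>i. d - i"])
      fix i assume i: "i \<in> {1..d}"
      have "n + (d - i) + M = n + N - i" using i N(1) by (auto simp: M_def)
      then show "poly (Q (d - i)) (of_nat n) * g (n + (d - i)) = poly (P i) (of_nat (n + N)) * f (n + N - i)"
        using i by (simp add: Q_def g_def poly_pcompose add.commute)
    qed auto
    finally show ?thesis .
  qed
  have Q_0: "Q 0 = [:c:]" using assms(1) c by (simp add: Q_def)
  \<comment> \<open>Besides the coefficients and the initial values, \<open>inverse c\<close> is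
    included to make the recurrence reversible over \<open>I 0\<close>.\<close>
  have "finite (insert (inverse c) ((\<Union>j<d. range (coeff (Q j))) \<union> g ` {..<d}))"
    by (intro finite.insertI finite_UnI finite_UN_I finite_range_coeff) auto
  then obtain p I where I: "padic_filtration p I"
    "insert (inverse c) ((\<Union>j<d. range (coeff (Q j))) \<union> g ` {..<d}) \<subseteq> I 0"
    using ex_padic_filtration by blast
  interpret padic_filtration p I by (rule I)
  have coeff_Q: "coeff (Q j) i \<in> I 0" for i j
    using I(2) by (cases "j < d") (auto simp: Q_def zero_mem)
  obtain a where a: "a > 0" "\<And>K n. (step_diff a ^^ K) g n \<in> I K"
  proof (rule recurrence_diff_small[where d = d and Q = Q and c = c])
    show "inverse c \<in> I 0" using I(2) by simp
    fix a assume a: "0 < a" "\<And>g K n. (\<And>n. g (n + d) = (\<Sum>i<d. poly (Q i) (of_nat n) * g (n + i))) \<Longrightarrow>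
      (\<And>n. n < d \<Longrightarrow> g n \<in> I 0) \<Longrightarrow> (step_diff a ^^ K) g n \<in> I K"
    have "(step_diff a ^^ K) g n \<in> I K" for K n using I(2) by (intro a(2) rec) auto
    with a(1) show thesis using that by blast
  qed (simp_all add: assms(1) coeff_Q Q_0 c(2))
  define Z where "Z = (\<lambda>b. {m. g (b + a * m) = 0})"
  \<comment> \<open>A class modulo \<open>a\<close> with infinitely many zeros consists of zeros and
    gives a progression; the other classes, and the indices below \<open>M\<close>, contribute
    finitely many.\<close>
  have full: "g (b + a * m) = 0" if "infinite (Z b)" for b m
    using infinite_zeros_imp_zero[OF a(2)] that unfolding Z_def by blast
  define \<A> where "\<A> = (\<lambda>b. {a * k + (b + M) | k. True}) ` {b. b < a \<and> infinite (Z b)}"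
  define F where "F = {n. n < M \<and> f n = 0} \<union> (\<Union>b\<in>{b. b < a \<and> finite (Z b)}. (\<lambda>m. b + a * m + M) ` Z b)"
  have "finite \<A>" "finite F" by (auto simp: \<A>_def F_def)
  moreover have "\<forall>A\<in>\<A>. arithmetic_progression A"
    using a(1) unfolding \<A>_def arithmetic_progression_def by blast
  moreover have "{n. f n = 0} = \<Union>\<A> \<union> F"
  proof (intro equalityI subsetI)
    fix n assume n: "n \<in> {n. f n = 0}"
    show "n \<in> \<Union>\<A> \<union> F"
    proof (cases "n < M")
      case True
      then show ?thesis using n by (simp add: F_def)
    next
      case False
      define b where "b = (n - M) mod a"
      define m where "m = (n - M) div a"
      have n_eq: "n = b + a * m + M" using False by (simp add: b_def m_def)
      have "b < a" using a(1) by (simp add: b_def)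
      have "m \<in> Z b" using n n_eq by (simp add: Z_def g_def)
      show ?thesis
      proof (cases "finite (Z b)")
        case True
        then show ?thesis using \<open>b < a\<close> \<open>m \<in> Z b\<close> n_eq by (auto simp: F_def)
      next
        case False
        have "n \<in> {a * k + (b + M) | k. True}" using n_eq by auto
        then show ?thesis using False \<open>b < a\<close> by (auto simp: \<A>_def)
      qed
    qed
  next
    fix n assume "n \<in> \<Union>\<A> \<union> F"
    then show "n \<in> {n. f n = 0}"
      using full by (auto simp: \<A>_def F_def Z_def g_def add_ac)
  qed
  ultimately show ?thesis by blast
qed

end
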